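(* Let $\mathbb F$ be a field of characteristic $2$, let $\lambda\vdash n$, and assume $\dim_{\mathbb F}\operatorname{Sp}^\lambda>1$. Then the Specht module $\operatorname{Sp}^\lambda$ has a one-dimensional direct summand as an $\mathbb F\mathfrak S_n$-module if and only if $\lambda=(n-r,1^r)$ is a hook satisfying: $n$ is odd, $r$ is even, and the binomial coefficient $\binom{n-1}{r}$ is odd.
   Context: A partition $\lambda\vdash n$ is a hook if $\lambda=(n-r,1^r)$ for some $0\le r\le n-1$. For $\lambda\vdash n$, let $M^\lambda$ be the permutation $\mathbb F\mathfrak S_n$-module with basis the set of $\lambda$-tabloids (row-equivalence classes $\{t\}$ of bijective fillings $t$ of the Young diagram of $\lambda$ with $1,\dots,n$). The Specht module $\operatorname{Sp}^\lambda$ (James's convention) is the submodule of $M^\lambda$ spanned by the polytabloids $e_t=\sum_{\pi\in C_t}\operatorname{sgn}(\pi)\,\{\pi t\}$, where $C_t\le\mathfrak S_n$ is the column stabilizer of $t$. In characteristic $2$ the trivial module is the unique one-dimensional $\mathbb F\mathfrak S_n$-module up to isomorphism. *)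

theory Defs
  imports "HOL-Combinatorics.Permutations" "HOL-Library.Function_Algebras"
    "HOL-Computational_Algebra.Computational_Algebra"
begin

definition is_partition :: "nat list \<Rightarrow> nat \<Rightarrow> bool" where
  "is_partition lam n \<longleftrightarrow> sorted_wrt (\<ge>) lam \<and> 0 \<notin> set lam \<and> sum_list lam = n"

definition cells :: "nat list \<Rightarrow> (nat \<times> nat) set" where
  "cells lam = {(i, j). i < length lam \<and> j < lam ! i}"

text \<open>
  A tableau takes the value 0, which is not an entry, outside the diagram. So a filling is a unique
  function, and every permutation of \<open>{1..n}\<close> (which fixes 0) acts on tableaux by composition.
\<close>

type_synonym tableau = "nat \<times> nat \<Rightarrow> nat"

definition tableaux :: "nat list \<Rightarrow> tableau set" where
  "tableaux lam = {t. bij_betw t (cells lam) {1..sum_list lam} \<and> (\<forall>c. c \<notin> cells lam \<longrightarrow> t c = 0)}"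

definition row_stabilizer :: "nat list \<Rightarrow> tableau \<Rightarrow> (nat \<Rightarrow> nat) set" where
  "row_stabilizer lam t = {p. p permutes {1..sum_list lam} \<and>
     (\<forall>c\<in>cells lam. \<exists>d\<in>cells lam. fst d = fst c \<and> p (t c) = t d)}"

definition column_stabilizer :: "nat list \<Rightarrow> tableau \<Rightarrow> (nat \<Rightarrow> nat) set" where
  "column_stabilizer lam t = {p. p permutes {1..sum_list lam} \<and>
     (\<forall>c\<in>cells lam. \<exists>d\<in>cells lam. snd d = snd c \<and> p (t c) = t d)}"

definition row_equivalence :: "nat list \<Rightarrow> (tableau \<times> tableau) set" where
  "row_equivalence lam = {(s, t). s \<in> tableaux lam \<and> t \<in> tableaux lam \<and>
     (\<exists>p\<in>row_stabilizer lam s. t = p \<circ> s)}"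

type_synonym tabloid = "tableau set"

definition tabloids :: "nat list \<Rightarrow> tabloid set" where
  "tabloids lam = tableaux lam // row_equivalence lam"

definition tabloid_of :: "nat list \<Rightarrow> tableau \<Rightarrow> tabloid" where
  "tabloid_of lam t = row_equivalence lam `` {t}"

definition act_tabloid :: "(nat \<Rightarrow> nat) \<Rightarrow> tabloid \<Rightarrow> tabloid" where
  "act_tabloid p X = (\<lambda>t. p \<circ> t) ` X"

text \<open>
  Vectors are functions from tabloids to the field, added pointwise; \<open>basis_vec X\<close> is the tabloid
  \<open>X\<close> as a basis vector.
\<close>

definition fscale :: "'f::field \<Rightarrow> ('b \<Rightarrow> 'f) \<Rightarrow> 'b \<Rightarrow> 'f" where
  "fscale c v = (\<lambda>x. c * v x)"

global_interpretation fvs: vector_space "fscale :: 'f::field \<Rightarrow> ('b \<Rightarrow> 'f) \<Rightarrow> 'b \<Rightarrow> 'f"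
  by unfold_locales (auto simp: fscale_def fun_eq_iff algebra_simps)

definition basis_vec :: "'b \<Rightarrow> 'b \<Rightarrow> 'f::field" where
  "basis_vec X = (\<lambda>Y. if Y = X then 1 else 0)"

definition perm_module :: "nat list \<Rightarrow> (tabloid \<Rightarrow> 'f::field) set" where
  "perm_module lam = fvs.span (basis_vec ` tabloids lam)"

text \<open>The linear action with \<open>basis_vec X \<mapsto> basis_vec (act_tabloid p X)\<close>.\<close>

definition act :: "(nat \<Rightarrow> nat) \<Rightarrow> (tabloid \<Rightarrow> 'f::field) \<Rightarrow> tabloid \<Rightarrow> 'f" where
  "act p v = (\<lambda>X. v (act_tabloid (inv p) X))"

definition submodule :: "nat list \<Rightarrow> (tabloid \<Rightarrow> 'f::field) set \<Rightarrow> bool" where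
  "submodule lam U \<longleftrightarrow> U \<subseteq> perm_module lam \<and> fvs.subspace U \<and>
     (\<forall>p. p permutes {1..sum_list lam} \<longrightarrow> (\<forall>u\<in>U. act p u \<in> U))"

definition polytabloid :: "nat list \<Rightarrow> tableau \<Rightarrow> tabloid \<Rightarrow> 'f::field" where
  "polytabloid lam t =
     (\<Sum>p\<in>column_stabilizer lam t. fscale (of_int (sign p)) (basis_vec (tabloid_of lam (p \<circ> t))))"

definition specht :: "nat list \<Rightarrow> (tabloid \<Rightarrow> 'f::field) set" where
  "specht lam = fvs.span (polytabloid lam ` tableaux lam)"

definition has_one_dim_summand :: "nat list \<Rightarrow> (tabloid \<Rightarrow> 'f::field) set \<Rightarrow> bool" where
  "has_one_dim_summand lam V \<longleftrightarrow> (\<exists>U W. submodule lam U \<and> submodule lam W \<and>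
     U \<inter> W = {0} \<and> V = {u + w | u w. u \<in> U \<and> w \<in> W} \<and> fvs.dim U = 1)"

lemma act_tabloid_inv:
  assumes "p permutes S"
  shows "act_tabloid (inv p) (act_tabloid p X) = X" "act_tabloid p (act_tabloid (inv p) X) = X"
proof -
  have a: "inv p \<circ> (p \<circ> t) = t" "p \<circ> (inv p \<circ> t) = t" for t :: tableau
    using permutes_inv_o[OF assms] by (simp_all add: o_assoc)
  show "act_tabloid (inv p) (act_tabloid p X) = X" "act_tabloid p (act_tabloid (inv p) X) = X"
    unfolding act_tabloid_def image_image a by simp_all
qed

lemma act_basis_vec:
  assumes "p permutes S"
  shows "act p (basis_vec X :: tabloid \<Rightarrow> 'f::field) = basis_vec (act_tabloid p X)"
  unfolding act_def basis_vec_def fun_eq_iff using act_tabloid_inv[OF assms] by metis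

lemma act_add: "act p (u + v) = act p u + act p v"
  by (simp add: act_def fun_eq_iff)

lemma act_fscale: "act p (fscale c v) = fscale c (act p v)"
  by (simp add: act_def fscale_def)

lemma act_zero: "act p 0 = 0"
  by (simp add: act_def fun_eq_iff)

lemma act_sum: "act p (sum f A) = (\<Sum>x\<in>A. act p (f x))"
  by (induction A rule: infinite_finite_induct) (simp_all only: act_zero act_add sum.infinite sum.empty sum.insert simp_thms)

lemma comp_in_tableaux:
  assumes t: "t \<in> tableaux lam" and p: "p permutes {1..sum_list lam}"
  shows "p \<circ> t \<in> tableaux lam"
proof -
  have "p 0 = 0" using permutes_not_in[OF p] by simp
  moreover have "bij_betw (p \<circ> t) (cells lam) {1..sum_list lam}"
    using t permutes_imp_bij[OF p] bij_betw_trans unfolding tableaux_def by blast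
  ultimately show ?thesis using t by (simp add: tableaux_def)
qed

lemma conj_row_stabilizer:
  assumes p: "p permutes {1..sum_list lam}" and q: "q \<in> row_stabilizer lam t"
  shows "p \<circ> q \<circ> inv p \<in> row_stabilizer lam (p \<circ> t)"
  unfolding row_stabilizer_def
proof (intro CollectI conjI ballI)
  show "p \<circ> q \<circ> inv p permutes {1..sum_list lam}"
    using assms by (auto simp only: row_stabilizer_def mem_Collect_eq intro!: permutes_compose permutes_inv)
  fix c assume "c \<in> cells lam"
  then obtain d where "d \<in> cells lam" "fst d = fst c" "q (t c) = t d"
    using q unfolding row_stabilizer_def by blast
  then show "\<exists>d\<in>cells lam. fst d = fst c \<and> (p \<circ> q \<circ> inv p) ((p \<circ> t) c) = (p \<circ> t) d"
    using permutes_inverses[OF p] by (intro bexI[of _ d]) simp_all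
qed

lemma conj_column_stabilizer:
  assumes p: "p permutes {1..sum_list lam}" and q: "q \<in> column_stabilizer lam t"
  shows "p \<circ> q \<circ> inv p \<in> column_stabilizer lam (p \<circ> t)"
  unfolding column_stabilizer_def
proof (intro CollectI conjI ballI)
  show "p \<circ> q \<circ> inv p permutes {1..sum_list lam}"
    using assms by (auto simp only: column_stabilizer_def mem_Collect_eq intro!: permutes_compose permutes_inv)
  fix c assume "c \<in> cells lam"
  then obtain d where "d \<in> cells lam" "snd d = snd c" "q (t c) = t d"
    using q unfolding column_stabilizer_def by blast
  then show "\<exists>d\<in>cells lam. snd d = snd c \<and> (p \<circ> q \<circ> inv p) ((p \<circ> t) c) = (p \<circ> t) d"
    using permutes_inverses[OF p] by (intro bexI[of _ d]) simp_all
qed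

lemma row_equivalence_comp:
  assumes p: "p permutes {1..sum_list lam}" and st: "(s, t) \<in> row_equivalence lam"
  shows "(p \<circ> s, p \<circ> t) \<in> row_equivalence lam"
proof -
  obtain q where q: "q \<in> row_stabilizer lam s" "t = q \<circ> s"
    using st unfolding row_equivalence_def by blast
  have "p \<circ> t = (p \<circ> q \<circ> inv p) \<circ> (p \<circ> s)"
    using q(2) permutes_inverses[OF p] by (simp add: fun_eq_iff)
  then show ?thesis
    using st conj_row_stabilizer[OF p q(1)] comp_in_tableaux[OF _ p]
    unfolding row_equivalence_def by blast
qed

lemma act_tabloid_of:
  assumes p: "p permutes {1..sum_list lam}"
  shows "act_tabloid p (tabloid_of lam t) = tabloid_of lam (p \<circ> t)"
proof
  show "act_tabloid p (tabloid_of lam t) \<subseteq> tabloid_of lam (p \<circ> t)"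
    using row_equivalence_comp[OF p] by (auto simp: act_tabloid_def tabloid_of_def)
  show "tabloid_of lam (p \<circ> t) \<subseteq> act_tabloid p (tabloid_of lam t)"
  proof
    fix s assume "s \<in> tabloid_of lam (p \<circ> t)"
    then have "(inv p \<circ> (p \<circ> t), inv p \<circ> s) \<in> row_equivalence lam"
      using row_equivalence_comp[OF permutes_inv[OF p]] by (simp add: tabloid_of_def)
    then have "inv p \<circ> s \<in> tabloid_of lam t"
      using permutes_inv_o[OF p] by (simp add: tabloid_of_def o_assoc)
    moreover have "s = p \<circ> (inv p \<circ> s)"
      using permutes_inv_o[OF p] by (simp add: o_assoc)
    ultimately show "s \<in> act_tabloid p (tabloid_of lam t)"
      unfolding act_tabloid_def by blast
  qed
qed

lemma act_polytabloid:
  assumes p: "p permutes {1..sum_list lam}"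
  shows "act p (polytabloid lam t :: tabloid \<Rightarrow> 'f::field) = polytabloid lam (p \<circ> t)"
proof -
  let ?S = "{1..sum_list lam}"
  have "act p (polytabloid lam t :: tabloid \<Rightarrow> 'f) =
    (\<Sum>q\<in>column_stabilizer lam t.
       fscale (of_int (sign q)) (basis_vec (tabloid_of lam (p \<circ> (q \<circ> t)))))"
    unfolding polytabloid_def act_sum act_fscale act_basis_vec[OF p] act_tabloid_of[OF p] ..
  also have "\<dots> = polytabloid lam (p \<circ> t)"
    unfolding polytabloid_def
  proof (rule sum.reindex_bij_witness[where i = "\<lambda>q. inv p \<circ> q \<circ> p" and j = "\<lambda>q. p \<circ> q \<circ> inv p"])
    fix q assume q: "q \<in> column_stabilizer lam t"
    show "p \<circ> q \<circ> inv p \<in> column_stabilizer lam (p \<circ> t)"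
      by (rule conj_column_stabilizer[OF p q])
    show "inv p \<circ> (p \<circ> q \<circ> inv p) \<circ> p = q"
      using permutes_inverses[OF p] by (simp add: fun_eq_iff)
    have perm: "permutation p" "permutation q" "permutation (inv p)"
      using p q permutes_inv[OF p] permutes_imp_permutation[of ?S]
      by (auto simp: column_stabilizer_def)
    have "sign (p \<circ> q \<circ> inv p) = sign q"
      using perm sign_idempotent[of p]
      by (simp add: sign_compose permutation_compose sign_inverse)
    moreover have "p \<circ> q \<circ> inv p \<circ> (p \<circ> t) = p \<circ> (q \<circ> t)"
      using permutes_inverses[OF p] by (simp add: fun_eq_iff)
    ultimately show "fscale (of_int (sign (p \<circ> q \<circ> inv p)))
        (basis_vec (tabloid_of lam (p \<circ> q \<circ> inv p \<circ> (p \<circ> t)))) =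
      (fscale (of_int (sign q)) (basis_vec (tabloid_of lam (p \<circ> (q \<circ> t)))) :: tabloid \<Rightarrow> 'f)"
      by simp
  next
    fix q assume q: "q \<in> column_stabilizer lam (p \<circ> t)"
    show "p \<circ> (inv p \<circ> q \<circ> p) \<circ> inv p = q"
      using permutes_inverses[OF p] by (simp add: fun_eq_iff)
    show "inv p \<circ> q \<circ> p \<in> column_stabilizer lam t"
      using conj_column_stabilizer[OF permutes_inv[OF p] q]
      by (simp add: o_assoc permutes_inv_inv[OF p] permutes_inv_o[OF p])
  qed
  finally show ?thesis .
qed

text \<open>
  The span of the polytabloids is closed under the action, so it is the submodule that they
  generate.
\<close>

lemma submodule_specht: "submodule lam (specht lam :: (tabloid \<Rightarrow> 'f::field) set)"
  unfolding submodule_def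
proof (intro conjI allI impI ballI)
  let ?V = "specht lam :: (tabloid \<Rightarrow> 'f) set"
  show "fvs.subspace ?V" by (simp add: specht_def)
  have "polytabloid lam t \<in> (perm_module lam :: (tabloid \<Rightarrow> 'f) set)"
    if t: "t \<in> tableaux lam" for t
    unfolding polytabloid_def perm_module_def
    using comp_in_tableaux[OF t]
    by (intro fvs.span_sum fvs.span_scale fvs.span_base)
      (auto simp: tabloids_def tabloid_of_def column_stabilizer_def intro!: imageI quotientI)
  then show "?V \<subseteq> perm_module lam"
    unfolding specht_def by (intro fvs.span_minimal) (auto simp: perm_module_def)
next
  fix p and u :: "tabloid \<Rightarrow> 'f"
  assume p: "p permutes {1..sum_list lam}" and "u \<in> specht lam"
  from this(2) show "act p u \<in> specht lam"
    unfolding specht_def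
  proof (induction rule: fvs.span_induct_alt)
    case base
    show ?case by (simp only: act_zero fvs.span_zero)
  next
    case (step c x y)
    then have "act p x \<in> fvs.span (polytabloid lam ` tableaux lam)"
      using comp_in_tableaux[OF _ p] by (auto simp: act_polytabloid[OF p] intro!: fvs.span_base)
    then show ?case
      unfolding act_add act_fscale by (intro fvs.span_add fvs.span_scale step.IH)
  qed
qed

end

theory Submission
  imports Defs
begin

text \<open>
  In characteristic 2 the symmetric group acts trivially on a one-dimensional summand, so the summand
  is spanned by the sum \<open>v\<close> of all tabloids, and the projection onto it is an invariant functional
  \<open>\<phi>\<close> on the Specht module with \<open>\<phi> v = 1\<close>; conversely such a functional splits off the line of \<open>v\<close>.

  The functional takes the same nonzero value on all polytabloids, so the coefficients of every linear
  relation between polytabloids sum to 0. The Garnir relations then say that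
  \<open>(c\<^sub>j + k) choose k\<close> is even for \<open>1 \<le> k \<le> c\<^sub>j\<^sub>+\<^sub>1\<close>, where \<open>c\<^sub>j\<close> are the column lengths. Dually, since
  \<open>v\<close> lies in the Specht module, the same holds for the row lengths. A third relation,
  obtained from an operator that sums over the inversions of a tabloid, shows that the sum of
  \<open>i * j\<close> over all cells \<open>(i, j)\<close> is even. If the second row has length at least 2, the binomial
  conditions force the lengths of the relevant rows and of the second column to be 3 modulo 4, and
  then this sum is odd. Hence the shape is a hook. There \<open>v\<close> is a sum of \<open>n choose (r + 1)\<close>
  polytabloids, which decides when \<open>\<phi> v\<close> is nonzero.
\<close>

section \<open>Tabloids as words\<close>

text \<open>In characteristic 2 the signs disappear, and a polytabloid has coefficient 1 at a
  tabloid exactly when the entries of each of its columns fill the rows of that column once each.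
  All relations thus become parity counts, proved by pairing off choices with a transposition.

  The third relation is needed because the binomial conditions alone do not single out hooks: the 3
  by 3 square meets all of them, as 4, 10 and 20 are even, and only its weight 9 excludes it. The
  weight \<open>N\<close> counts the pairs of cells of which one lies strictly north-west of the
  other. For the operator \<open>T\<close> in question, \<open>\<phi> (T x) = N * \<phi> x\<close>
  on the Specht module, while \<open>T v = 0\<close> because all coefficients of \<open>v\<close>
  agree. The operator refers to the order of the entries, yet \<open>\<phi>\<close> turns it into a
  scalar: changing the order costs only vectors \<open>x + act p x\<close>, which every invariant
  functional kills.\<close>

definition rowlen :: "nat list \<Rightarrow> nat \<Rightarrow> nat" where
  "rowlen lam i = (if i < length lam then lam ! i else 0)"

definition collen :: "nat list \<Rightarrow> nat \<Rightarrow> nat" where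
  "collen lam j = card {i. (i, j) \<in> cells lam}"

definition col_set :: "nat list \<Rightarrow> tableau \<Rightarrow> nat \<Rightarrow> nat set" where
  "col_set lam t j = t ` {c \<in> cells lam. snd c = j}"

text \<open>
  A tabloid is encoded by the word sending each entry to the index of its row; entries outside
  \<open>{1..n}\<close> are sent to 0, so that words are unique functions.
\<close>

definition row_word :: "nat list \<Rightarrow> tableau \<Rightarrow> nat \<Rightarrow> nat" where
  "row_word lam t = (\<lambda>p. if p \<in> t ` cells lam then fst (inv_into (cells lam) t p) else 0)"

definition words :: "nat list \<Rightarrow> (nat \<Rightarrow> nat) set" where
  "words lam = row_word lam ` tableaux lam"

definition tabloid_of_word :: "nat list \<Rightarrow> (nat \<Rightarrow> nat) \<Rightarrow> tabloid" where
  "tabloid_of_word lam w = {t \<in> tableaux lam. row_word lam t = w}"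

text \<open>Coordinates are meaningful on \<open>words lam\<close> only: for any other
  \<open>w\<close> the set \<open>tabloid_of_word lam w\<close> is empty and hence no
  tabloid.\<close>

definition coef :: "nat list \<Rightarrow> (tabloid \<Rightarrow> 'f) \<Rightarrow> (nat \<Rightarrow> nat) \<Rightarrow> 'f" where
  "coef lam x w = x (tabloid_of_word lam w)"

text \<open>Depends on \<open>t\<close> only through the sets of entries of its columns. In
  characteristic 2 it decides whether the polytabloid of \<open>t\<close> involves the tabloid of
  \<open>w\<close>.\<close>

definition transversal :: "nat list \<Rightarrow> (nat \<Rightarrow> nat) \<Rightarrow> tableau \<Rightarrow> bool" where
  "transversal lam w t \<longleftrightarrow> (\<forall>j. bij_betw w (col_set lam t j) {..<collen lam j})"

section \<open>Diagrams and tableaux\<close>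

lemma finite_cells [simp]: "finite (cells lam)"
proof -
  have "cells lam = (SIGMA i:{..<length lam}. {..<lam ! i})"
    by (auto simp: cells_def)
  then show ?thesis by simp
qed

lemma card_cells: "card (cells lam) = sum_list lam"
proof -
  have "cells lam = (SIGMA i:{..<length lam}. {..<lam ! i})"
    by (auto simp: cells_def)
  then show ?thesis by (simp add: sum_list_sum_nth atLeast0LessThan)
qed

lemma mem_cells_rowlen: "(i, j) \<in> cells lam \<longleftrightarrow> j < rowlen lam i"
  by (auto simp: cells_def rowlen_def)

lemma rowlen_mono:
  assumes "is_partition lam n" "i \<le> i'"
  shows "rowlen lam i' \<le> rowlen lam i"
proof (cases "i = i' \<or> i' \<ge> length lam")
  case False
  then show ?thesis
    using assms by (auto simp: is_partition_def rowlen_def sorted_wrt_iff_nth_less)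
qed (auto simp: rowlen_def)

text \<open>Decreasing row lengths make the rows meeting a column an initial segment, which its
  cardinality then determines. So \<open>collen\<close> is the conjugate partition.\<close>

lemma mem_cells_collen:
  assumes "is_partition lam n"
  shows "(i, j) \<in> cells lam \<longleftrightarrow> i < collen lam j"
proof -
  define A where "A = {i. (i, j) \<in> cells lam}"
  have fin: "finite A"
    by (rule finite_subset[of _ "{..<length lam}"]) (auto simp: A_def cells_def)
  have down: "i' \<in> A" if "i \<in> A" "i' \<le> i" for i i'
    using that rowlen_mono[OF assms that(2)] by (simp add: A_def mem_cells_rowlen)
  have "\<exists>m. A = {..<m}"
  proof (cases "A = {}")
    case False
    have "A = {..Max A}"
      using Max_ge[OF fin] down[OF Max_in[OF fin False]] by blast
    then show ?thesis by (metis lessThan_Suc_atMost)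
  qed auto
  then obtain m where "A = {..<m}" ..
  then have "i \<in> A \<longleftrightarrow> i < card A" by simp
  then show ?thesis by (simp add: collen_def A_def)
qed

lemma tableaux_bij: "t \<in> tableaux lam \<Longrightarrow> bij_betw t (cells lam) {1..sum_list lam}"
  by (simp add: tableaux_def)

lemma tableaux_image: "t \<in> tableaux lam \<Longrightarrow> t ` cells lam = {1..sum_list lam}"
  using tableaux_bij bij_betw_imp_surj_on by blast

lemma tableaux_inj: "t \<in> tableaux lam \<Longrightarrow> inj_on t (cells lam)"
  using tableaux_bij bij_betw_imp_inj_on by blast

lemma tableaux_outside: "t \<in> tableaux lam \<Longrightarrow> c \<notin> cells lam \<Longrightarrow> t c = 0"
  by (cases c) (simp add: tableaux_def)

lemma tableaux_nonempty: "tableaux lam \<noteq> {}"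
proof -
  obtain h where h: "bij_betw h (cells lam) {1..sum_list lam}"
    using finite_same_card_bij[of "cells lam" "{1..sum_list lam}"] card_cells by auto
  define t where "t = (\<lambda>c. if c \<in> cells lam then h c else 0)"
  have "bij_betw t (cells lam) {1..sum_list lam}"
    using h by (rule bij_betw_cong[THEN iffD1, rotated]) (simp add: t_def)
  then have "t \<in> tableaux lam" by (simp add: tableaux_def t_def)
  then show ?thesis by blast
qed

section \<open>Row words under the group action\<close>

lemma row_word_cell:
  assumes "t \<in> tableaux lam" "c \<in> cells lam"
  shows "row_word lam t (t c) = fst c"
  using assms by (auto simp: row_word_def inv_into_f_f[OF tableaux_inj])

lemma row_word_outside:
  assumes "t \<in> tableaux lam" "p \<notin> {1..sum_list lam}"
  shows "row_word lam t p = 0"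
  using assms tableaux_image by (auto simp: row_word_def)

lemma row_word_eqI:
  assumes t: "t \<in> tableaux lam"
    and "\<And>c. c \<in> cells lam \<Longrightarrow> w (t c) = fst c" "\<And>p. p \<notin> {1..sum_list lam} \<Longrightarrow> w p = 0"
  shows "row_word lam t = w"
proof
  fix p
  show "row_word lam t p = w p"
  proof (cases "p \<in> {1..sum_list lam}")
    case True
    then obtain c where "c \<in> cells lam" "p = t c" using tableaux_image[OF t] by blast
    then show ?thesis using assms row_word_cell[OF t] by simp
  qed (use assms row_word_outside in auto)
qed

lemma row_word_comp:
  assumes t: "t \<in> tableaux lam" and p: "p permutes {1..sum_list lam}"
  shows "row_word lam (p \<circ> t) = row_word lam t \<circ> inv p"
proof (rule row_word_eqI[OF comp_in_tableaux[OF t p]])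
  fix c assume "c \<in> cells lam"
  then show "(row_word lam t \<circ> inv p) ((p \<circ> t) c) = fst c"
    using permutes_inverses[OF p] row_word_cell[OF t] by simp
next
  fix q assume "q \<notin> {1..sum_list lam}"
  then show "(row_word lam t \<circ> inv p) q = 0"
    using permutes_not_in[OF permutes_inv[OF p]] row_word_outside[OF t] by simp
qed

lemma words_comp:
  assumes "w \<in> words lam" and p: "p permutes {1..sum_list lam}"
  shows "w \<circ> p \<in> words lam"
proof -
  obtain t where t: "t \<in> tableaux lam" "w = row_word lam t"
    using assms(1) by (auto simp: words_def)
  have "row_word lam (inv p \<circ> t) = w \<circ> p"
    using row_word_comp[OF t(1) permutes_inv[OF p]] permutes_inv_inv[OF p] t(2) by simp
  then show ?thesis
    using comp_in_tableaux[OF t(1) permutes_inv[OF p]] by (force simp: words_def)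
qed

lemma words_outside:
  "w \<in> words lam \<Longrightarrow> p \<notin> {1..sum_list lam} \<Longrightarrow> w p = 0"
  using row_word_outside by (auto simp: words_def)

lemma tableaux_transitive:
  assumes s: "s \<in> tableaux lam" and t: "t \<in> tableaux lam"
  obtains p where "p permutes {1..sum_list lam}" "t = p \<circ> s"
proof -
  let ?S = "{1..sum_list lam}"
  define p where "p = (\<lambda>x. if x \<in> ?S then t (inv_into (cells lam) s x) else x)"
  have "bij_betw (t \<circ> inv_into (cells lam) s) ?S ?S"
    using bij_betw_trans[OF bij_betw_inv_into[OF tableaux_bij[OF s]] tableaux_bij[OF t]] .
  then have "bij_betw p ?S ?S"
    by (rule bij_betw_cong[THEN iffD1, rotated]) (simp add: p_def)
  then have perm: "p permutes ?S"
    by (rule bij_imp_permutes) (simp only: p_def if_False)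
  have "t c = p (s c)" for c
  proof (cases "c \<in> cells lam")
    case True
    then have "s c \<in> ?S" using tableaux_image[OF s] by blast
    then show ?thesis using True by (simp add: p_def inv_into_f_f[OF tableaux_inj[OF s]])
  next
    case False
    then have "s c = 0" "t c = 0" using tableaux_outside s t by blast+
    then show ?thesis by (simp add: p_def)
  qed
  then show thesis using that[OF perm] by (auto simp: fun_eq_iff)
qed

text \<open>The permutation carrying \<open>s\<close> to \<open>t\<close> stabilizes the rows
  exactly when no entry changes its row, so words encode tabloids faithfully.\<close>

lemma row_equivalence_iff:
  "(s, t) \<in> row_equivalence lam \<longleftrightarrow>
    s \<in> tableaux lam \<and> t \<in> tableaux lam \<and> row_word lam s = row_word lam t"
proof safe
  assume "(s, t) \<in> row_equivalence lam"
  then obtain p where st: "s \<in> tableaux lam" "t \<in> tableaux lam"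
    and p: "p \<in> row_stabilizer lam s" "t = p \<circ> s"
    by (auto simp: row_equivalence_def)
  show "s \<in> tableaux lam" "t \<in> tableaux lam" by (rule st)+
  have "row_word lam t = row_word lam s"
  proof (rule row_word_eqI[OF st(2)])
    fix c assume "c \<in> cells lam"
    then obtain d where "d \<in> cells lam" "fst d = fst c" "p (s c) = s d"
      using p(1) by (auto simp: row_stabilizer_def)
    then show "row_word lam s (t c) = fst c"
      using row_word_cell[OF st(1)] p(2) by simp
  qed (use row_word_outside[OF st(1)] in auto)
  then show "row_word lam s = row_word lam t" ..
next
  assume st: "s \<in> tableaux lam" "t \<in> tableaux lam" and eq: "row_word lam s = row_word lam t"
  obtain p where p: "p permutes {1..sum_list lam}" "t = p \<circ> s"
    using tableaux_transitive[OF st] .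
  have "\<exists>d\<in>cells lam. fst d = fst c \<and> p (s c) = s d" if c: "c \<in> cells lam" for c
  proof -
    have "t c \<in> s ` cells lam" using c tableaux_image st by blast
    then obtain d where d: "d \<in> cells lam" "t c = s d" by blast
    have "fst d = row_word lam s (t c)" using row_word_cell[OF st(1)] d by simp
    also have "\<dots> = fst c" using row_word_cell[OF st(2) c] eq by simp
    finally show ?thesis using d p(2) by auto
  qed
  then show "(s, t) \<in> row_equivalence lam"
    using st p by (auto simp: row_equivalence_def row_stabilizer_def)
qed

lemma tabloid_of_eq:
  "t \<in> tableaux lam \<Longrightarrow> tabloid_of lam t = tabloid_of_word lam (row_word lam t)"
  by (auto simp: tabloid_of_def tabloid_of_word_def row_equivalence_iff)

lemma tabloid_of_word_inj:
  assumes "w \<in> words lam" "tabloid_of_word lam w = tabloid_of_word lam w'"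
  shows "w = w'"
  using assms by (force simp: words_def tabloid_of_word_def)

lemma tabloids_eq: "tabloids lam = tabloid_of_word lam ` words lam"
proof -
  have "tabloids lam = tabloid_of lam ` tableaux lam"
    by (auto simp: tabloids_def tabloid_of_def quotient_def)
  also have "\<dots> = tabloid_of_word lam ` words lam"
    by (auto simp: tabloid_of_eq words_def image_image)
  finally show ?thesis .
qed

lemma act_tabloid_of_word:
  assumes w: "w \<in> words lam" and p: "p permutes {1..sum_list lam}"
  shows "act_tabloid p (tabloid_of_word lam w) = tabloid_of_word lam (w \<circ> inv p)"
proof -
  obtain t where t: "t \<in> tableaux lam" "w = row_word lam t"
    using w by (auto simp: words_def)
  show ?thesis
    using act_tabloid_of[OF p, of t] row_word_comp[OF t(1) p] tabloid_of_eq
      comp_in_tableaux[OF t(1) p] t by simp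
qed

text \<open>The inverse in \<open>act\<close> cancels the one in \<open>row_word_comp\<close>, so
  the action becomes precomposition with \<open>p\<close> itself.\<close>

lemma coef_act:
  assumes "w \<in> words lam" and p: "p permutes {1..sum_list lam}"
  shows "coef lam (act p x) w = coef lam x (w \<circ> p)"
  using act_tabloid_of_word[OF assms(1) permutes_inv[OF p]] permutes_inv_inv[OF p]
  by (simp add: coef_def act_def)

lemma coef_add: "coef lam (x + y) w = coef lam x w + coef lam y w"
  by (simp add: coef_def)

lemma coef_zero: "coef lam 0 w = 0"
  by (simp add: coef_def)

lemma coef_fscale: "coef lam (fscale c x) w = c * coef lam x w"
  by (simp add: coef_def fscale_def)

lemma coef_sum: "coef lam (sum f A) w = (\<Sum>a\<in>A. coef lam (f a) w)"
  by (induction A rule: infinite_finite_induct)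
    (simp_all only: coef_zero coef_add sum.infinite sum.empty sum.insert simp_thms)

lemma perm_module_support:
  assumes "x \<in> perm_module lam" "X \<notin> tabloids lam"
  shows "x X = 0"
  using assms(1) unfolding perm_module_def
proof (induction rule: fvs.span_induct_alt)
  case (step c y z)
  then have "y X = 0" using assms(2) by (auto simp: basis_vec_def)
  then show ?case using step by (simp add: fscale_def)
qed simp

lemma perm_module_eqI:
  assumes "x \<in> perm_module lam" "y \<in> perm_module lam"
    and "\<And>w. w \<in> words lam \<Longrightarrow> coef lam x w = coef lam y w"
  shows "x = y"
proof
  fix X
  show "x X = y X"
    using assms perm_module_support[of x lam X] perm_module_support[of y lam X]
    by (cases "X \<in> tabloids lam") (auto simp: tabloids_eq coef_def)
qed

lemma specht_subset: "specht lam \<subseteq> perm_module lam"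
  using submodule_specht[of lam] unfolding submodule_def by (rule conjunct1)

lemma polytabloid_in_specht: "t \<in> tableaux lam \<Longrightarrow> polytabloid lam t \<in> specht lam"
  unfolding specht_def by (intro fvs.span_base imageI)

section \<open>Polytabloids in characteristic 2\<close>

lemma char_2_add_self: "CHAR('f::field) = 2 \<Longrightarrow> (x::'f) + x = 0"
  using uminus_CHAR_2[where 'a = 'f, of x] by (metis add.right_inverse)

lemma char_2_of_nat:
  assumes "CHAR('f::field) = 2"
  shows "(of_nat k :: 'f) = of_bool (odd k)"
proof -
  have zero: "(of_nat (2 * m) :: 'f) = 0" for m
    using of_nat_eq_0_iff_char_dvd[where 'a = 'f, of "2 * m"] assms by simp
  show ?thesis
  proof (cases "even k")
    case True
    then show ?thesis using zero by (elim evenE) simp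
  next
    case False
    then obtain m where "k = 2 * m + 1" by (elim oddE)
    then have "(of_nat k :: 'f) = of_nat (2 * m) + 1" by (simp only: of_nat_add of_nat_1)
    then show ?thesis using zero False by simp
  qed
qed

text \<open>The parity counts for rows, columns and inversions all end here, each with an involution
  built from a transposition.\<close>

lemma char_2_card_involution:
  assumes "CHAR('f::field) = 2"
    and "\<And>x. x \<in> X \<Longrightarrow> h x \<in> X" "\<And>x. x \<in> X \<Longrightarrow> h (h x) = x" "\<And>x. x \<in> X \<Longrightarrow> h x \<noteq> x"
  shows "(of_nat (card X) :: 'f) = 0"
  using sum_involution_eq_0[of X "\<lambda>_. 1 :: 'f" h] assms(2-) char_2_add_self[OF assms(1)] by simp

lemma col_set_comp: "col_set lam (p \<circ> t) j = p ` col_set lam t j"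
  by (auto simp: col_set_def)

lemma col_set_subset: "t \<in> tableaux lam \<Longrightarrow> col_set lam t j \<subseteq> {1..sum_list lam}"
  using tableaux_image by (auto simp: col_set_def)

lemma finite_col_set [simp]: "finite (col_set lam t j)"
  by (simp add: col_set_def)

lemma col_set_disjoint:
  assumes "t \<in> tableaux lam" "p \<in> col_set lam t j" "p \<in> col_set lam t j'"
  shows "j = j'"
  using assms inj_onD[OF tableaux_inj[OF assms(1)]] by (auto simp: col_set_def)

lemma col_set_cover:
  assumes "t \<in> tableaux lam" "p \<in> {1..sum_list lam}"
  obtains j where "p \<in> col_set lam t j"
proof -
  obtain c where "c \<in> cells lam" "p = t c"
    using assms tableaux_image[OF assms(1)] by blast
  then show thesis using that[of "snd c"] by (auto simp: col_set_def)
qed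

lemma row_word_bij_col:
  assumes lam: "is_partition lam n" and t: "t \<in> tableaux lam"
  shows "bij_betw (row_word lam t) (col_set lam t j) {..<collen lam j}"
proof (rule bij_betw_byWitness[where f' = "\<lambda>i. t (i, j)"])
  show "\<forall>p\<in>col_set lam t j. t (row_word lam t p, j) = p"
    using row_word_cell[OF t] by (auto simp: col_set_def)
  show "\<forall>i\<in>{..<collen lam j}. row_word lam t (t (i, j)) = i"
    using row_word_cell[OF t] mem_cells_collen[OF lam] by auto
  show "row_word lam t ` col_set lam t j \<subseteq> {..<collen lam j}"
    using row_word_cell[OF t] mem_cells_collen[OF lam] by (auto simp: col_set_def)
  show "(\<lambda>i. t (i, j)) ` {..<collen lam j} \<subseteq> col_set lam t j"
    using mem_cells_collen[OF lam] by (auto simp: col_set_def)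
qed

lemma card_col_set:
  assumes "is_partition lam n" "t \<in> tableaux lam"
  shows "card (col_set lam t j) = collen lam j"
  using bij_betw_same_card[OF row_word_bij_col[OF assms]] by simp

lemma column_stabilizer_image:
  assumes t: "t \<in> tableaux lam" and p: "p \<in> column_stabilizer lam t"
  shows "p ` col_set lam t j = col_set lam t j"
proof (rule card_subset_eq)
  have perm: "p permutes {1..sum_list lam}"
    using p by (simp add: column_stabilizer_def)
  show "p ` col_set lam t j \<subseteq> col_set lam t j"
  proof
    fix y assume "y \<in> p ` col_set lam t j"
    then obtain c where c: "c \<in> cells lam" "snd c = j" "y = p (t c)"
      by (auto simp: col_set_def)
    then obtain d where "d \<in> cells lam" "snd d = snd c" "p (t c) = t d"
      using p unfolding column_stabilizer_def by blast
    then show "y \<in> col_set lam t j" using c by (auto simp: col_set_def)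
  qed
  show "card (p ` col_set lam t j) = card (col_set lam t j)"
    by (rule card_image) (rule permutes_inj_on[OF perm])
qed simp

lemma column_stabilizerI:
  assumes t: "t \<in> tableaux lam" and p: "p permutes {1..sum_list lam}"
    and im: "\<And>j. p ` col_set lam t j = col_set lam t j"
  shows "p \<in> column_stabilizer lam t"
proof -
  have "\<exists>d\<in>cells lam. snd d = snd c \<and> p (t c) = t d" if c: "c \<in> cells lam" for c
  proof -
    have "p (t c) \<in> p ` col_set lam t (snd c)" using c by (auto simp: col_set_def)
    then have "p (t c) \<in> col_set lam t (snd c)" by (simp only: im)
    then show ?thesis by (auto simp: col_set_def)
  qed
  then show ?thesis using p by (simp add: column_stabilizer_def)
qed

lemma transversal_comp:
  assumes "\<And>j. bij_betw q (col_set lam t j) (col_set lam t j)"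
  shows "transversal lam (w \<circ> q) t \<longleftrightarrow> transversal lam w t"
  unfolding transversal_def by (simp add: bij_betw_comp_iff[OF assms, symmetric])

lemma transversal_tableau_comp:
  assumes "p permutes {1..sum_list lam}"
  shows "transversal lam w (p \<circ> t) \<longleftrightarrow> (\<forall>j. bij_betw w (p ` col_set lam t j) {..<collen lam j})"
  by (simp add: transversal_def col_set_comp)

lemma bij_col_inv:
  assumes t: "t \<in> tableaux lam" and p: "p \<in> column_stabilizer lam t"
  shows "bij_betw (inv p) (col_set lam t j) (col_set lam t j)"
proof -
  have perm: "p permutes {1..sum_list lam}"
    using p by (simp add: column_stabilizer_def)
  have "inv p ` col_set lam t j = inv p ` p ` col_set lam t j"
    by (simp only: column_stabilizer_image[OF t p])
  also have "\<dots> = col_set lam t j"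
    by (simp add: image_image permutes_inverses[OF perm])
  finally show ?thesis
    using permutes_inj_on[OF permutes_inv[OF perm]] by (simp add: bij_betw_def)
qed

text \<open>A column permutation taking \<open>t\<close> to the word \<open>w\<close> must have an
  inverse that sends each entry \<open>x\<close> of column \<open>j\<close> to the entry of
  \<open>t\<close> in cell \<open>(w x, j)\<close>. So there is at most one, and it exists exactly
  when \<open>w\<close> meets every row of each column once.\<close>

lemma ex1_column_stabilizer:
  assumes lam: "is_partition lam n" and t: "t \<in> tableaux lam" and w: "w \<in> words lam"
  shows "{p \<in> column_stabilizer lam t. row_word lam (p \<circ> t) = w} = {} \<and> \<not> transversal lam w t \<or>
    (\<exists>p. {p \<in> column_stabilizer lam t. row_word lam (p \<circ> t) = w} = {p}) \<and> transversal lam w t"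
    (is "?A = {} \<and> _ \<or> _")
proof -
  let ?S = "{1..sum_list lam}" and ?r = "row_word lam t"
  have A: "p permutes ?S \<and> w = ?r \<circ> inv p" if "p \<in> ?A" for p
    using that row_word_comp[OF t] by (auto simp: column_stabilizer_def)
  have trans: "transversal lam w t" if p: "p \<in> ?A" for p
  proof -
    have "transversal lam ?r t"
      using row_word_bij_col[OF lam t] by (simp add: transversal_def)
    then show ?thesis
      using A[OF p] transversal_comp[OF bij_col_inv[OF t], of p ?r] p by auto
  qed
  have unique: "p = q" if p: "p \<in> ?A" and q: "q \<in> ?A" for p q
  proof -
    have "inv p x = inv q x" for x
    proof (cases "x \<in> ?S")
      case True
      then obtain j where j: "x \<in> col_set lam t j" using col_set_cover[OF t] by blast
      have "inv p x \<in> col_set lam t j" "inv q x \<in> col_set lam t j"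
        using bij_betw_apply[OF bij_col_inv[OF t] j] p q by auto
      moreover have "?r (inv p x) = ?r (inv q x)" using A[OF p] A[OF q] by (metis comp_apply)
      ultimately show ?thesis
        using row_word_bij_col[OF lam t, of j] by (auto simp: bij_betw_def inj_on_def)
    next
      case False
      then show ?thesis
        using A[OF p] A[OF q] permutes_not_in[OF permutes_inv] by metis
    qed
    then have "inv p = inv q" by (rule ext)
    then show ?thesis using A[OF p] A[OF q] permutes_inv_inv by metis
  qed
  have exist: "\<exists>p. p \<in> ?A" if tr: "transversal lam w t"
  proof -
    \<comment> \<open>This is the forced inverse, so the permutation sought is
      \<open>inv q\<close>.\<close>
    define q where "q = (\<lambda>x. if x \<in> ?S then t (w x, snd (inv_into (cells lam) t x)) else x)"
    have q_col: "q x = t (w x, j) \<and> (w x, j) \<in> cells lam" if x: "x \<in> col_set lam t j" for x j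
    proof -
      have "x \<in> ?S" using x col_set_subset[OF t] by blast
      moreover have "snd (inv_into (cells lam) t x) = j"
        using x inv_into_f_f[OF tableaux_inj[OF t]] by (auto simp: col_set_def)
      moreover have "w x < collen lam j"
        using tr x bij_betw_apply by (fastforce simp: transversal_def)
      ultimately show ?thesis using mem_cells_collen[OF lam] by (simp add: q_def)
    qed
    have bij: "bij_betw q (col_set lam t j) (col_set lam t j)" for j
    proof -
      have "inj_on q (col_set lam t j)"
      proof (rule inj_onI)
        fix x y assume xy: "x \<in> col_set lam t j" "y \<in> col_set lam t j" "q x = q y"
        then have "w x = w y"
          using q_col inj_onD[OF tableaux_inj[OF t], of "(w x, j)" "(w y, j)"] by simp
        then show "x = y" using tr xy by (auto simp: transversal_def bij_betw_def inj_on_def)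
      qed
      moreover have "q ` col_set lam t j \<subseteq> col_set lam t j"
        using q_col by (auto simp: col_set_def)
      ultimately show ?thesis by (simp add: bij_betw_def endo_inj_surj)
    qed
    have perm: "q permutes ?S"
    proof (rule bij_imp_permutes)
      have "inj_on q ?S"
      proof (rule inj_onI)
        fix x y assume xy: "x \<in> ?S" "y \<in> ?S" "q x = q y"
        obtain j j' where j: "x \<in> col_set lam t j" "y \<in> col_set lam t j'"
          using col_set_cover[OF t] xy by metis
        then have "j = j'"
          using xy(3) bij_betw_apply[OF bij] col_set_disjoint[OF t] by metis
        then show "x = y" using bij[of j] j xy(3) by (auto simp: bij_betw_def inj_on_def)
      qed
      moreover have "q ` ?S \<subseteq> ?S"
      proof
        fix y assume "y \<in> q ` ?S"
        then obtain x where x: "x \<in> ?S" "y = q x" by blast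
        obtain j where "x \<in> col_set lam t j" using col_set_cover[OF t x(1)] .
        then show "y \<in> ?S" using x(2) bij_betw_apply[OF bij] col_set_subset[OF t] by blast
      qed
      ultimately show "bij_betw q ?S ?S" by (simp add: bij_betw_def endo_inj_surj)
    qed (simp only: q_def if_False)
    have "inv q ` col_set lam t j = col_set lam t j" for j
    proof -
      have "inv q ` col_set lam t j = inv q ` q ` col_set lam t j"
        using bij[of j] by (simp only: bij_betw_def)
      also have "\<dots> = col_set lam t j"
        by (simp add: image_image permutes_inverses[OF perm])
      finally show ?thesis .
    qed
    then have cs: "inv q \<in> column_stabilizer lam t"
      by (intro column_stabilizerI[OF t permutes_inv[OF perm]])
    have "row_word lam (inv q \<circ> t) = ?r \<circ> q"
      using row_word_comp[OF t permutes_inv[OF perm]] permutes_inv_inv[OF perm] by simp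
    also have "\<dots> = w"
    proof
      fix x
      show "(?r \<circ> q) x = w x"
      proof (cases "x \<in> ?S")
        case True
        then obtain j where "x \<in> col_set lam t j" using col_set_cover[OF t] by blast
        then show ?thesis using q_col row_word_cell[OF t] by fastforce
      next
        case False
        then show ?thesis
          using permutes_not_in[OF perm False] words_outside[OF w False] row_word_outside[OF t False] by simp
      qed
    qed
    finally show ?thesis using cs by blast
  qed
  show ?thesis using trans unique exist by blast
qed

text \<open>All signs are 1, so the coefficient counts the column permutations that lead from
  \<open>t\<close> to \<open>w\<close>, of which there is at most one. From here on only the column
  sets of \<open>t\<close> matter.\<close>

lemma coef_polytabloid:
  assumes ch: "CHAR('f::field) = 2" and lam: "is_partition lam n"
    and t: "t \<in> tableaux lam" and w: "w \<in> words lam"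
  shows "coef lam (polytabloid lam t) w = (of_bool (transversal lam w t) :: 'f)"
proof -
  let ?C = "column_stabilizer lam t"
  have fin: "finite ?C"
    by (rule finite_subset[of _ "{p. p permutes {1..sum_list lam}}"])
      (auto simp: column_stabilizer_def finite_permutations)
  have sgn: "(of_int (sign p) :: 'f) = 1" for p :: "nat \<Rightarrow> nat"
    using uminus_CHAR_2[OF ch, of 1] by (simp add: sign_def)
  have basis: "coef lam (basis_vec (tabloid_of lam (p \<circ> t))) w =
      (of_bool (row_word lam (p \<circ> t) = w) :: 'f)" if "p \<in> ?C" for p
  proof -
    have "p \<circ> t \<in> tableaux lam"
      using that comp_in_tableaux[OF t] by (simp add: column_stabilizer_def)
    then show ?thesis
      using tabloid_of_word_inj[OF w] by (auto simp: coef_def basis_vec_def tabloid_of_eq)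
  qed
  have "coef lam (polytabloid lam t) w =
      (\<Sum>p\<in>?C. of_bool (row_word lam (p \<circ> t) = w) :: 'f)"
    unfolding polytabloid_def coef_sum coef_fscale
    by (rule sum.cong) (simp_all add: sgn basis)
  also have "\<dots> = of_nat (card {p \<in> ?C. row_word lam (p \<circ> t) = w})"
    using fin by (simp add: of_bool_def sum.If_cases Int_def)
  also have "card {p \<in> ?C. row_word lam (p \<circ> t) = w} = of_bool (transversal lam w t)"
  proof (use ex1_column_stabilizer[OF lam t w] in \<open>elim disjE conjE exE\<close>)
    fix p assume "{p \<in> ?C. row_word lam (p \<circ> t) = w} = {p}" "transversal lam w t"
    then show ?thesis by (simp only: card_1_singleton_iff of_bool_eq) auto
  qed (simp_all only: card.empty of_bool_eq simp_thms)
  finally show ?thesis by simp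
qed

section \<open>Invariant functionals on the Specht module\<close>

text \<open>A homomorphism to the trivial module. Since \<open>\<phi>\<close> is a total function on
  vectors, the conditions are imposed on \<open>specht lam\<close> only.\<close>

definition invariant_functional :: "nat list \<Rightarrow> ((tabloid \<Rightarrow> 'f::field) \<Rightarrow> 'f) \<Rightarrow> bool" where
  "invariant_functional lam \<phi> \<longleftrightarrow>
     (\<forall>x\<in>specht lam. \<forall>y\<in>specht lam. \<phi> (x + y) = \<phi> x + \<phi> y) \<and>
     (\<forall>c. \<forall>x\<in>specht lam. \<phi> (fscale c x) = c * \<phi> x) \<and>
     (\<forall>p x. p permutes {1..sum_list lam} \<longrightarrow> x \<in> specht lam \<longrightarrow> \<phi> (act p x) = \<phi> x)"

lemma invariant_functional_add:
  "invariant_functional lam \<phi> \<Longrightarrow> x \<in> specht lam \<Longrightarrow> y \<in> specht lam \<Longrightarrow> \<phi> (x + y) = \<phi> x + \<phi> y"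
  by (simp add: invariant_functional_def)

lemma invariant_functional_fscale:
  "invariant_functional lam \<phi> \<Longrightarrow> x \<in> specht lam \<Longrightarrow> \<phi> (fscale c x) = c * \<phi> x"
  by (simp add: invariant_functional_def)

lemma invariant_functional_act:
  "invariant_functional lam \<phi> \<Longrightarrow> p permutes {1..sum_list lam} \<Longrightarrow> x \<in> specht lam \<Longrightarrow>
    \<phi> (act p x) = \<phi> x"
  by (simp add: invariant_functional_def)

lemma specht_zero: "0 \<in> specht lam"
  unfolding specht_def by (rule fvs.span_zero)

lemma specht_add: "x \<in> specht lam \<Longrightarrow> y \<in> specht lam \<Longrightarrow> x + y \<in> specht lam"
  unfolding specht_def by (rule fvs.span_add)

lemma specht_fscale: "x \<in> specht lam \<Longrightarrow> fscale c x \<in> specht lam"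
  unfolding specht_def by (rule fvs.span_scale)

lemma specht_sum: "(\<And>a. a \<in> A \<Longrightarrow> f a \<in> specht lam) \<Longrightarrow> sum f A \<in> specht lam"
  unfolding specht_def by (rule fvs.span_sum)

lemma specht_act: "p permutes {1..sum_list lam} \<Longrightarrow> x \<in> specht lam \<Longrightarrow> act p x \<in> specht lam"
  using submodule_specht[of lam] unfolding submodule_def by blast

lemma invariant_functional_zero:
  assumes "invariant_functional lam \<phi>"
  shows "\<phi> 0 = 0"
  using invariant_functional_fscale[OF assms specht_zero, of 0] by simp

lemma invariant_functional_sum:
  assumes inv: "invariant_functional lam \<phi>" and "\<And>a. a \<in> A \<Longrightarrow> f a \<in> specht lam"
  shows "\<phi> (sum f A) = (\<Sum>a\<in>A. \<phi> (f a))"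
  using assms(2)
proof (induction A rule: infinite_finite_induct)
  case (insert a A)
  then have "\<phi> (f a + sum f A) = \<phi> (f a) + \<phi> (sum f A)"
    by (intro invariant_functional_add[OF inv] specht_sum) auto
  moreover have "\<phi> (sum f A) = (\<Sum>a\<in>A. \<phi> (f a))"
    using insert by blast
  ultimately show ?case by (simp only: sum.insert[OF insert.hyps])
next
  case (infinite A)
  then show ?case by (simp only: sum.infinite[OF infinite(1)] invariant_functional_zero[OF inv] not_False_eq_True)
next
  case empty
  show ?case unfolding sum.empty by (rule invariant_functional_zero[OF inv])
qed

text \<open>The symmetric group permutes the polytabloids transitively.\<close>

lemma invariant_functional_polytabloid:
  assumes inv: "invariant_functional lam \<phi>" and s: "s \<in> tableaux lam" and t: "t \<in> tableaux lam"
  shows "\<phi> (polytabloid lam t) = \<phi> (polytabloid lam s)"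
proof -
  obtain p where p: "p permutes {1..sum_list lam}" "t = p \<circ> s"
    using tableaux_transitive[OF s t] .
  show ?thesis
    unfolding p(2) act_polytabloid[OF p(1), symmetric]
    by (rule invariant_functional_act[OF inv p(1) polytabloid_in_specht[OF s]])
qed

lemma specht_eqI:
  assumes "x \<in> specht lam" "y \<in> specht lam"
    and "\<And>w. w \<in> words lam \<Longrightarrow> coef lam x w = coef lam y w"
  shows "x = y"
  using assms specht_subset perm_module_eqI by blast

text \<open>Both summands carry membership in \<open>specht lam\<close>, because invariant
  functionals are linear only there.\<close>

lemma specht_induct [consumes 1, case_names zero add polytabloid]:
  assumes "x \<in> specht lam" and "P 0"
    and "\<And>x y c. x \<in> specht lam \<Longrightarrow> y \<in> specht lam \<Longrightarrow> P x \<Longrightarrow> P y \<Longrightarrow> P (fscale c x + y)"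
    and "\<And>t. t \<in> tableaux lam \<Longrightarrow> P (polytabloid lam t)"
  shows "P x"
proof -
  have "x \<in> specht lam \<and> P x"
    using assms(1) unfolding specht_def
  proof (induction rule: fvs.span_induct_alt)
    case base
    then show ?case using assms(2) by (simp only: fvs.span_zero simp_thms)
  next
    case (step c x y)
    then obtain t where t: "t \<in> tableaux lam" "x = polytabloid lam t" by blast
    then have x: "x \<in> specht lam" by (simp add: polytabloid_in_specht)
    have "P (fscale c x + y)"
      using assms(3)[OF x] step.IH assms(4)[OF t(1)] t(2) by (simp add: specht_def)
    moreover have "fscale c x + y \<in> fvs.span (polytabloid lam ` tableaux lam)"
      using specht_add[OF specht_fscale[OF x]] step.IH unfolding specht_def by blast
    ultimately show ?case by (rule conjI[rotated])
  qed
  then show ?thesis ..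
qed

lemma transversal_equal_entries:
  assumes "transversal lam w t" "a \<in> col_set lam t j" "b \<in> col_set lam t j" "w a = w b"
  shows "a = b"
  using assms by (auto simp: transversal_def bij_betw_def inj_on_def)

lemma bij_transpose_col_set:
  assumes t: "t \<in> tableaux lam" and "a \<in> col_set lam t j" "b \<in> col_set lam t j"
  shows "bij_betw (transpose a b) (col_set lam t l) (col_set lam t l)"
proof -
  have "transpose a b ` col_set lam t l = col_set lam t l"
  proof (cases "l = j")
    case True
    then show ?thesis using assms by (simp add: transpose_image_eq)
  next
    case False
    then have "a \<notin> col_set lam t l" "b \<notin> col_set lam t l"
      using assms col_set_disjoint[OF t] by blast+
    then show ?thesis by (simp add: transpose_image_eq)
  qed
  then show ?thesis by (simp add: bij_betw_def)
qed

lemma transversal_transpose: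
  assumes "t \<in> tableaux lam" "a \<in> col_set lam t j" "b \<in> col_set lam t j"
  shows "transversal lam (w \<circ> transpose a b) t \<longleftrightarrow> transversal lam w t"
  by (rule transversal_comp) (rule bij_transpose_col_set[OF assms])

lemma word_less_collen:
  assumes "transversal lam w t" "a \<in> col_set lam t j"
  shows "w a < collen lam j"
  using assms bij_betw_apply unfolding transversal_def by fastforce

lemma transversal_obtain:
  assumes "transversal lam w t" "i < collen lam j"
  obtains b where "b \<in> col_set lam t j" "w b = i"
  using assms unfolding transversal_def bij_betw_def by (metis imageE lessThan_iff)

lemma card_word_fiber:
  assumes "w \<in> words lam"
  shows "card {p \<in> {1..sum_list lam}. w p = i} = rowlen lam i"
proof -
  obtain t where t: "t \<in> tableaux lam" "w = row_word lam t"
    using assms by (auto simp: words_def)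
  have "{p \<in> {1..sum_list lam}. w p = i} = t ` {c \<in> cells lam. fst c = i}"
    unfolding tableaux_image[OF t(1), symmetric] t(2) by (auto simp: row_word_cell[OF t(1)])
  also have "{c \<in> cells lam. fst c = i} = Pair i ` {..<rowlen lam i}"
    by (auto simp: mem_cells_rowlen)
  finally have "{p \<in> {1..sum_list lam}. w p = i} = (t \<circ> Pair i) ` {..<rowlen lam i}"
    by (simp only: image_comp)
  moreover have "inj_on (t \<circ> Pair i) {..<rowlen lam i}"
    by (intro comp_inj_on inj_onI inj_on_subset[OF tableaux_inj[OF t(1)]])
      (auto simp: mem_cells_rowlen)
  ultimately show ?thesis using card_image[of "t \<circ> Pair i"] by simp
qed

lemma obtain_permutes_image:
  assumes "finite X" "P \<subseteq> X" "Q \<subseteq> X" "card P = card Q"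
  obtains p where "p permutes X" "p ` P = Q"
proof -
  have fin: "finite P" "finite Q" using assms finite_subset by auto
  obtain f where f: "bij_betw f P Q"
    using finite_same_card_bij[OF fin assms(4)] by blast
  have "card (X - P) = card (X - Q)"
    using assms fin by (simp add: card_Diff_subset)
  then obtain g where g: "bij_betw g (X - P) (X - Q)"
    using finite_same_card_bij[of "X - P" "X - Q"] assms(1) by blast
  define p where "p = (\<lambda>x. if x \<in> P then f x else if x \<in> X then g x else x)"
  have "bij_betw p P Q"
    using f by (rule bij_betw_cong[THEN iffD1, rotated]) (simp add: p_def)
  moreover have "bij_betw p (X - P) (X - Q)"
    using g by (rule bij_betw_cong[THEN iffD1, rotated]) (simp add: p_def)
  ultimately have "bij_betw p (P \<union> (X - P)) (Q \<union> (X - Q))"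
    by (rule bij_betw_combine) auto
  then have "bij_betw p X X" using assms by (simp add: Un_absorb1)
  then have "p permutes X"
    by (rule bij_imp_permutes) (use assms(2) in \<open>auto simp: p_def\<close>)
  then show thesis using that \<open>bij_betw p P Q\<close> by (simp add: bij_betw_def)
qed

section \<open>Binomial conditions on rows and columns\<close>

lemma collen_mono:
  assumes lam: "is_partition lam n" and "j \<le> j'"
  shows "collen lam j' \<le> collen lam j"
proof (rule ccontr)
  assume "\<not> collen lam j' \<le> collen lam j"
  then have "(collen lam j, j') \<in> cells lam" by (simp add: mem_cells_collen[OF lam])
  then have "(collen lam j, j) \<in> cells lam" using \<open>j \<le> j'\<close> by (simp add: mem_cells_rowlen)
  then show False by (simp add: mem_cells_collen[OF lam])
qed

lemma transpose_image_involution: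
  assumes "a \<in> P \<longleftrightarrow> b \<notin> P"
  shows "transpose a b ` transpose a b ` P = P" "transpose a b ` P \<noteq> P"
    "card (transpose a b ` P) = card P"
proof -
  show "transpose a b ` transpose a b ` P = P" by (simp add: image_image)
  have "b \<in> transpose a b ` P \<longleftrightarrow> a \<in> P"
    by (simp add: in_transpose_image_iff)
  then show "transpose a b ` P \<noteq> P" using assms by metis
  show "card (transpose a b ` P) = card P"
    by (rule card_image) simp
qed

text \<open>
  Fix \<open>k\<close> entries in row \<open>i + 1\<close>. Summing coefficients over all choices of \<open>k\<close> elements, among
  these and the entries of row \<open>i\<close>, to be put into row \<open>i + 1\<close> annihilates every polytabloid: the
  transversal choices are paired by swapping two entries of a common column. On the constant
  vector the sum counts the choices.
\<close>

lemma row_condition: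
  fixes v :: "tabloid \<Rightarrow> 'f::field"
  assumes ch: "CHAR('f) = 2" and lam: "is_partition lam n"
    and v: "v \<in> specht lam" "\<And>w. w \<in> words lam \<Longrightarrow> coef lam v w = 1"
    and k: "1 \<le> k" "k \<le> rowlen lam (Suc i)"
  shows "even ((rowlen lam i + k) choose k)"
proof -
  let ?S = "{1..sum_list lam}"
  obtain w0 where w0: "w0 \<in> words lam"
    using tableaux_nonempty[of lam] by (auto simp: words_def)
  define A where "A = {p \<in> ?S. w0 p = i}"
  have "k \<le> card {p \<in> ?S. w0 p = Suc i}" using k(2) card_word_fiber[OF w0] by simp
  then obtain B where B: "B \<subseteq> {p \<in> ?S. w0 p = Suc i}" "card B = k" "finite B"
    using obtain_subset_with_card_n by blast
  define X where "X = A \<union> B"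
  have X: "finite X" "X \<subseteq> ?S" using B by (auto simp: X_def A_def)
  have "card X = card A + card B"
    unfolding X_def by (rule card_Un_disjoint) (use B in \<open>auto simp: A_def\<close>)
  then have cardX: "card X = rowlen lam i + k"
    using card_word_fiber[OF w0] B by (simp add: A_def)
  define Sub where "Sub = {P. P \<subseteq> X \<and> card P = k}"
  have cardSub: "card Sub = (rowlen lam i + k) choose k"
    using n_subsets[OF X(1), of k] cardX by (simp add: Sub_def)
  define y where "y = (\<lambda>P p. if p \<in> P then Suc i else if p \<in> X then i else w0 p)"
  have y_words: "y P \<in> words lam" if P: "P \<in> Sub" for P
  proof -
    \<comment> \<open>A permutation of \<open>X\<close> carrying \<open>P\<close> to
      \<open>B\<close> turns \<open>w0\<close> into \<open>y P\<close>, which is therefore a word of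
      the same shape.\<close>
    obtain p where p: "p permutes X" "p ` P = B"
      using obtain_permutes_image[OF X(1), of P B] P B(2) by (auto simp: Sub_def X_def)
    have "y P = w0 \<circ> p"
    proof
      fix q
      consider "q \<in> P" | "q \<in> X" "q \<notin> P" | "q \<notin> X" by blast
      then show "y P q = (w0 \<circ> p) q"
      proof cases
        case 1
        then have "p q \<in> B" using p(2) by blast
        then show ?thesis using 1 B(1) by (auto simp: y_def)
      next
        case 2
        then have "p q \<in> X" using permutes_in_image[OF p(1)] by simp
        moreover have "p q \<notin> B"
          using 2(2) inj_image_mem_iff[OF permutes_inj[OF p(1)], of q P] p(2) by simp
        ultimately show ?thesis using 2 by (auto simp: y_def X_def A_def)
      next
        case 3
        then have "q \<notin> P" using P by (auto simp: Sub_def)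
        then show ?thesis using 3 permutes_not_in[OF p(1) 3] by (simp add: y_def)
      qed
    qed
    then show ?thesis using words_comp[OF w0 permutes_subset[OF p(1) X(2)]] by simp
  qed
  \<comment> \<open>This sum is a coefficient of the image of \<open>x\<close> under the map that
    moves \<open>k\<close> entries of row \<open>i + 1\<close> up into row \<open>i\<close>, one of
    the maps in James's kernel intersection theorem.\<close>
  have "(\<Sum>P\<in>Sub. coef lam x (y P)) = 0" if "x \<in> specht lam" for x :: "tabloid \<Rightarrow> 'f"
    using that
  proof (induction rule: specht_induct)
    case zero
    show ?case by (simp only: coef_zero sum.neutral_const)
  next
    case (add x x' c)
    then show ?case
      by (simp only: coef_add coef_fscale sum.distrib sum_distrib_left[symmetric]) simp
  next
    case (polytabloid t)
    define T where "T = {P \<in> Sub. transversal lam (y P) t}"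
    have finSub: "finite Sub" using X(1) by (simp add: Sub_def)
    have "(\<Sum>P\<in>Sub. coef lam (polytabloid lam t) (y P)) =
        (\<Sum>P\<in>Sub. of_bool (transversal lam (y P) t) :: 'f)"
      by (intro sum.cong refl coef_polytabloid[OF ch lam polytabloid] y_words)
    also have "\<dots> = of_nat (card T)"
      using finSub by (simp add: T_def of_bool_def sum.If_cases Int_def)
    also have "\<dots> = 0"
    proof (cases "T = {}")
      case False
      then obtain P0 where P0: "P0 \<subseteq> X" "card P0 = k" "transversal lam (y P0) t"
        by (auto simp: T_def Sub_def)
      have "P0 \<noteq> {}" using P0(2) k(1) by auto
      then obtain a where a: "a \<in> P0" by blast
      obtain j where j: "a \<in> col_set lam t j"
        using col_set_cover[OF polytabloid] a P0(1) X(2) by blast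
      have "Suc i < collen lam j"
        using word_less_collen[OF P0(3) j] a by (simp add: y_def)
      \<comment> \<open>Column \<open>j\<close> has an entry in row \<open>i + 1\<close>, hence also
        one in row \<open>i\<close>; all entries that \<open>y P0\<close> puts there belong to
        \<open>X\<close>.\<close>
      then obtain b where b: "b \<in> col_set lam t j" "y P0 b = i"
        using transversal_obtain[OF P0(3), of i j] by auto
      have "b \<in> ?S" using b(1) col_set_subset[OF polytabloid] by blast
      then have bX: "b \<in> X" "b \<notin> P0"
        using b(2) by (auto simp: y_def X_def A_def split: if_splits)
      have aX: "a \<in> X" using a P0(1) by blast
      have "a \<noteq> b" using a bX(2) by blast
      \<comment> \<open>One pair serves all of \<open>T\<close>: both entries lie in
        \<open>X\<close>, so every \<open>y P\<close> puts them in rows \<open>i\<close> or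
        \<open>i + 1\<close>, and as members of one column they must occupy both.\<close>
      have split: "a \<in> P \<longleftrightarrow> b \<notin> P" if "P \<in> T" for P
      proof -
        have "y P a \<noteq> y P b"
          using transversal_equal_entries[of lam "y P" t a j b] that j b(1) \<open>a \<noteq> b\<close>
          by (auto simp: T_def)
        then show ?thesis using aX bX(1) by (auto simp: y_def split: if_splits)
      qed
      have step: "transpose a b ` P \<in> T" if P: "P \<in> T" for P
      proof -
        have sub: "P \<subseteq> X" "card P = k" "transversal lam (y P) t"
          using P by (auto simp: T_def Sub_def)
        have "y (transpose a b ` P) = y P \<circ> transpose a b"
          using aX bX(1) by (auto simp: y_def fun_eq_iff in_transpose_image_iff transpose_def)
        then have "transversal lam (y (transpose a b ` P)) t"
          using transversal_transpose[OF polytabloid j b(1)] sub(3) by simp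
        moreover have "transpose a b ` P \<subseteq> X"
          using sub(1) aX bX(1) by (auto simp: transpose_def)
        ultimately show ?thesis
          using transpose_image_involution(3)[OF split[OF P]] sub(2) by (simp add: T_def Sub_def)
      qed
      show ?thesis
        by (rule char_2_card_involution[OF ch, of T "\<lambda>P. transpose a b ` P"])
          (fact step, (rule transpose_image_involution(1,2)[OF split], assumption)+)
    qed simp
    finally show ?case .
  qed
  from this[OF v(1)] have "(\<Sum>P\<in>Sub. coef lam v (y P)) = 0" .
  moreover have "(\<Sum>P\<in>Sub. coef lam v (y P)) = (\<Sum>P\<in>Sub. 1)"
    by (intro sum.cong refl v(2) y_words)
  ultimately have "(of_nat (card Sub) :: 'f) = 0" by simp
  then show ?thesis unfolding cardSub char_2_of_nat[OF ch] by simp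
qed

text \<open>
  The Garnir relation for column \<open>j\<close> and \<open>k\<close> entries of column \<open>j + 1\<close>: the sum of the polytabloids
  over all redistributions vanishes, while an invariant functional is constant on polytabloids.
\<close>

lemma column_condition:
  fixes \<phi> :: "(tabloid \<Rightarrow> 'f::field) \<Rightarrow> 'f"
  assumes ch: "CHAR('f) = 2" and lam: "is_partition lam n"
    and inv: "invariant_functional lam \<phi>"
    and t: "t \<in> tableaux lam" "\<phi> (polytabloid lam t) \<noteq> 0"
    and k: "1 \<le> k" "k \<le> collen lam (Suc j)"
  shows "even ((collen lam j + k) choose k)"
proof -
  let ?S = "{1..sum_list lam}" and ?C = "col_set lam t"
  obtain Y0 where Y0: "Y0 \<subseteq> ?C (Suc j)" "card Y0 = k" "finite Y0"
    using obtain_subset_with_card_n[of k "?C (Suc j)"] k(2) card_col_set[OF lam t(1)] by auto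
  define X where "X = ?C j \<union> Y0"
  have disj: "?C l \<inter> ?C l' = {}" if "l \<noteq> l'" for l l'
    using that col_set_disjoint[OF t(1)] by blast
  have dj: "?C j \<inter> ?C (Suc j) = {}" by (rule disj) simp
  have X: "finite X" "X \<subseteq> ?S"
    using Y0 col_set_subset[OF t(1)] by (auto simp: X_def)
  have XY0: "X - Y0 = ?C j" using dj Y0(1) by (auto simp: X_def)
  have "card X = card (?C j) + card Y0"
    unfolding X_def by (rule card_Un_disjoint) (use Y0 dj in auto)
  then have cardX: "card X = collen lam j + k"
    using card_col_set[OF lam t(1)] Y0(2) by simp
  define Sub where "Sub = {P. P \<subseteq> X \<and> card P = k}"
  have cardSub: "card Sub = (collen lam j + k) choose k"
    using n_subsets[OF X(1), of k] cardX by (simp add: Sub_def)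
  have finSub: "finite Sub" using X(1) by (simp add: Sub_def)
  have "\<exists>p. p permutes X \<and> p ` Y0 = Y" if "Y \<in> Sub" for Y
  proof -
    have "Y0 \<subseteq> X" "Y \<subseteq> X" "card Y0 = card Y" using that Y0(2) by (auto simp: Sub_def X_def)
    then show ?thesis using obtain_permutes_image[OF X(1)] by metis
  qed
  then obtain p where p: "\<And>Y. Y \<in> Sub \<Longrightarrow> p Y permutes X" "\<And>Y. Y \<in> Sub \<Longrightarrow> p Y ` Y0 = Y"
    by metis
  have pS: "p Y permutes ?S" if "Y \<in> Sub" for Y
    by (rule permutes_subset[OF p(1)[OF that] X(2)])
  \<comment> \<open>The column sets of \<open>p Y \<circ> t\<close>. They determine the polytabloid,
    whichever \<open>p Y\<close> was chosen.\<close>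
  define G where "G = (\<lambda>Y l. if l = j then X - Y
      else if l = Suc j then (?C (Suc j) - Y0) \<union> Y else ?C l)"
  have pG: "p Y ` ?C l = G Y l" if Y: "Y \<in> Sub" for Y l
  proof -
    have fixp: "p Y ` M = M" if "M \<inter> X = {}" for M
    proof -
      have "p Y x = x" if "x \<in> M" for x
        using permutes_not_in[OF p(1)[OF Y]] that \<open>M \<inter> X = {}\<close> by blast
      then show ?thesis by simp
    qed
    consider "l = j" | "l = Suc j" | "l \<noteq> j" "l \<noteq> Suc j" by blast
    then show ?thesis
    proof cases
      case 1
      have "p Y ` (X - Y0) = p Y ` X - p Y ` Y0"
        by (rule image_set_diff[OF permutes_inj[OF p(1)[OF Y]]])
      then show ?thesis
        using 1 by (simp only: XY0 permutes_image[OF p(1)[OF Y]] p(2)[OF Y] G_def simp_thms if_True)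
    next
      case 2
      have "?C (Suc j) = (?C (Suc j) - Y0) \<union> Y0" using Y0(1) by blast
      then have "p Y ` ?C (Suc j) = p Y ` (?C (Suc j) - Y0) \<union> p Y ` Y0"
        by (metis image_Un)
      moreover have "(?C (Suc j) - Y0) \<inter> X = {}" using dj by (auto simp: X_def)
      ultimately show ?thesis using 2 fixp p(2)[OF Y] by (simp add: G_def)
    next
      case 3
      have "?C l \<inter> X = {}"
        using disj[OF 3(1)] disj[OF 3(2)] Y0(1) by (auto simp: X_def)
      then show ?thesis using 3 fixp by (simp add: G_def)
    qed
  qed
  have trans: "transversal lam w (p Y \<circ> t) \<longleftrightarrow> (\<forall>l. bij_betw w (G Y l) {..<collen lam l})"
    if "Y \<in> Sub" for Y w
    by (simp only: transversal_tableau_comp[OF pS[OF that]] pG[OF that])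
  let ?x = "\<Sum>Y\<in>Sub. polytabloid lam (p Y \<circ> t) :: tabloid \<Rightarrow> 'f"
  have tab: "p Y \<circ> t \<in> tableaux lam" if "Y \<in> Sub" for Y
    by (rule comp_in_tableaux[OF t(1) pS[OF that]])
  have "?x = 0"
  proof (rule specht_eqI[where lam = lam])
    show "?x \<in> specht lam" by (intro specht_sum polytabloid_in_specht tab)
    show "0 \<in> specht lam" by (rule specht_zero)
    fix w assume w: "w \<in> words lam"
    define T where "T = {Y \<in> Sub. \<forall>l. bij_betw w (G Y l) {..<collen lam l}}"
    have "coef lam ?x w = (\<Sum>Y\<in>Sub. of_bool (\<forall>l. bij_betw w (G Y l) {..<collen lam l}) :: 'f)"
      unfolding coef_sum
    proof (rule sum.cong)
      fix Y assume Y: "Y \<in> Sub"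
      show "coef lam (polytabloid lam (p Y \<circ> t)) w =
          (of_bool (\<forall>l. bij_betw w (G Y l) {..<collen lam l}) :: 'f)"
        by (simp only: coef_polytabloid[OF ch lam tab[OF Y] w] trans[OF Y])
    qed simp
    also have "\<dots> = of_nat (card T)"
      using finSub by (simp add: T_def of_bool_def sum.If_cases Int_def)
    also have "\<dots> = 0"
    proof (cases "T = {}")
      case False
      then obtain Y1 where Y1: "Y1 \<in> Sub" "\<And>l. bij_betw w (G Y1 l) {..<collen lam l}"
        by (auto simp: T_def)
      have "Y1 \<noteq> {}" using Y1(1) k(1) by (auto simp: Sub_def)
      then obtain a where a: "a \<in> Y1" by blast
      have aX: "a \<in> X" using a Y1(1) by (auto simp: Sub_def)
      have "a \<in> G Y1 (Suc j)" using a by (simp add: G_def)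
      \<comment> \<open>Column \<open>j\<close> is at least as long as column \<open>j + 1\<close>,
        so the row of \<open>a\<close> also occurs among the entries placed in column
        \<open>j\<close>.\<close>
      then have "w a < collen lam (Suc j)" using bij_betw_apply[OF Y1(2)] by blast
      then have "w a \<in> {..<collen lam j}" using collen_mono[OF lam, of j "Suc j"] by simp
      then have "w a \<in> w ` G Y1 j" using bij_betw_imp_surj_on[OF Y1(2)] by simp
      then obtain b where b: "b \<in> X" "b \<notin> Y1" "w a = w b" by (auto simp: G_def)
      have "a \<noteq> b" using a b(2) by blast
      \<comment> \<open>\<open>w\<close> puts \<open>a\<close> and \<open>b\<close> in the same row,
        so no column of a transversal redistribution can hold both.\<close>
      have split: "a \<in> Y \<longleftrightarrow> b \<notin> Y" if "Y \<in> T" for Y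
      proof -
        have bij: "inj_on w (G Y l)" for l using that by (simp add: T_def bij_betw_def)
        have "\<not> (a \<in> G Y l \<and> b \<in> G Y l)" for l
          using inj_onD[OF bij b(3)] \<open>a \<noteq> b\<close> by blast
        from this[of j] this[of "Suc j"] show ?thesis using aX b(1) by (auto simp: G_def)
      qed
      \<comment> \<open>Here the exchange fixes the word and moves the column sets; in the row
        condition it is the other way round.\<close>
      have wtr: "w \<circ> transpose a b = w"
        using b(3) by (auto simp: fun_eq_iff transpose_def)
      have step: "transpose a b ` Y \<in> T" if Y: "Y \<in> T" for Y
      proof -
        have sub: "Y \<subseteq> X" "card Y = k" "\<And>l. bij_betw w (G Y l) {..<collen lam l}"
          using Y by (auto simp: T_def Sub_def)
        have XX: "transpose a b ` X = X" using aX b(1) by (simp add: transpose_image_eq)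
        have "bij_betw w (G (transpose a b ` Y) l) {..<collen lam l}" for l
        proof -
          have fixp: "transpose a b ` M = M" if "M \<inter> X = {}" for M
            using that aX b(1) by (intro transpose_image_eq) blast
          have "G (transpose a b ` Y) l = transpose a b ` G Y l"
          proof -
            consider "l = j" | "l = Suc j" | "l \<noteq> j" "l \<noteq> Suc j" by blast
            then show ?thesis
            proof cases
              case 1
              then show ?thesis
                by (simp add: G_def image_set_diff[OF inj_transpose] XX)
            next
              case 2
              have "(?C (Suc j) - Y0) \<inter> X = {}" using dj by (auto simp: X_def)
              then show ?thesis using 2 fixp by (simp add: G_def image_Un)
            next
              case 3
              have "?C l \<inter> X = {}"
                using disj[OF 3(1)] disj[OF 3(2)] Y0(1) by (auto simp: X_def)
              then show ?thesis using 3 fixp by (simp add: G_def)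
            qed
          qed
          moreover have "bij_betw (transpose a b) (G Y l) (transpose a b ` G Y l)"
            by (intro inj_on_imp_bij_betw) simp
          ultimately show ?thesis
            using bij_betw_comp_iff[of "transpose a b" "G Y l" _ w "{..<collen lam l}"]
              sub(3)[of l] wtr by metis
        qed
        moreover have "transpose a b ` Y \<subseteq> X"
          using image_mono[OF sub(1), of "transpose a b"] XX by simp
        ultimately show ?thesis
          using transpose_image_involution(3)[OF split[OF Y]] sub(2) by (simp add: T_def Sub_def)
      qed
      show ?thesis
        by (rule char_2_card_involution[OF ch, of T "\<lambda>P. transpose a b ` P"])
          (fact step, (rule transpose_image_involution(1,2)[OF split], assumption)+)
    qed simp
    finally show "coef lam ?x w = coef lam 0 w" by (simp only: coef_zero)
  qed
  then have "\<phi> ?x = 0" using invariant_functional_zero[OF inv] by simp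
  moreover have "\<phi> ?x = (\<Sum>Y\<in>Sub. \<phi> (polytabloid lam (p Y \<circ> t)))"
    by (intro invariant_functional_sum[OF inv] polytabloid_in_specht tab)
  moreover have "\<dots> = (\<Sum>Y\<in>Sub. \<phi> (polytabloid lam t))"
    by (intro sum.cong refl invariant_functional_polytabloid[OF inv t(1)] tab)
  ultimately have "of_nat (card Sub) * \<phi> (polytabloid lam t) = 0" by simp
  then have "(of_nat (card Sub) :: 'f) = 0" using t(2) by simp
  then show ?thesis unfolding cardSub char_2_of_nat[OF ch] by simp
qed

section \<open>The parity of the cell weight\<close>

definition col_of :: "nat list \<Rightarrow> tableau \<Rightarrow> nat \<Rightarrow> nat" where
  "col_of lam t p = snd (inv_into (cells lam) t p)"

text \<open>
  This operator kills the constant vector. Modulo the vectors \<open>e\<^sub>t + act \<tau> e\<^sub>t\<close>, on which invariant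
  functionals vanish, it multiplies each polytabloid \<open>e\<^sub>t\<close> by the sum of \<open>i * j\<close> over all cells.
\<close>

definition inversion_operator ::
  "nat list \<Rightarrow> ((nat \<Rightarrow> nat) \<Rightarrow> 'f::field) \<Rightarrow> (nat \<Rightarrow> nat) \<Rightarrow> 'f" where
  "inversion_operator lam c w =
     (\<Sum>(p, q) | p \<in> {1..sum_list lam} \<and> q \<in> {1..sum_list lam} \<and> p < q.
       if w p < w q then c w + c (w \<circ> transpose p q) else 0)"

lemma col_of_eq_iff:
  assumes t: "t \<in> tableaux lam" and p: "p \<in> {1..sum_list lam}"
  shows "col_of lam t p = j \<longleftrightarrow> p \<in> col_set lam t j"
proof -
  obtain c where c: "c \<in> cells lam" "p = t c"
    using p tableaux_image[OF t] by blast
  have "col_of lam t p = snd c"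
    using inv_into_f_f[OF tableaux_inj[OF t] c(1)] c(2) by (simp add: col_of_def)
  moreover have "p \<in> col_set lam t (snd c)" using c by (auto simp: col_set_def)
  ultimately show ?thesis using col_set_disjoint[OF t] by metis
qed

lemma mem_col_set_col_of:
  "t \<in> tableaux lam \<Longrightarrow> p \<in> {1..sum_list lam} \<Longrightarrow> p \<in> col_set lam t (col_of lam t p)"
  using col_of_eq_iff by blast

text \<open>On passing from the order of the entries to the order by \<open>f\<close>, a pair that
  both orders rank alike keeps its term, a pair ranked oppositely is replaced by its mirror image at
  the cost of \<open>E p q\<close>, and ties contribute 0. Later \<open>f\<close> is the column
  index.\<close>

lemma sum_pairs_resort:
  fixes D E :: "nat \<Rightarrow> nat \<Rightarrow> 'f::field" and f :: "nat \<Rightarrow> nat"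
  assumes ch: "CHAR('f) = 2" and fin: "finite S"
    and E: "\<And>p q. p \<in> S \<Longrightarrow> q \<in> S \<Longrightarrow> D p q + D q p = E p q"
    and D: "\<And>p q. p \<in> S \<Longrightarrow> q \<in> S \<Longrightarrow> f p = f q \<Longrightarrow> D p q = 0"
  shows "(\<Sum>(p, q) | p \<in> S \<and> q \<in> S \<and> p < q. D p q) =
    (\<Sum>(p, q) | p \<in> S \<and> q \<in> S \<and> f p < f q. D p q) +
    (\<Sum>(p, q) | p \<in> S \<and> q \<in> S \<and> p < q \<and> f q < f p. E p q)"
proof -
  let ?up = "{(p, q). p \<in> S \<and> q \<in> S \<and> p < q \<and> f p < f q}"
  let ?down = "{(p, q). p \<in> S \<and> q \<in> S \<and> p < q \<and> f q < f p}"
  let ?down' = "{(p, q). p \<in> S \<and> q \<in> S \<and> q < p \<and> f p < f q}"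
  have finP: "finite {(p, q). p \<in> S \<and> q \<in> S \<and> P p q}" for P
    by (rule finite_subset[of _ "S \<times> S"]) (use fin in auto)
  have "(\<Sum>(p, q) | p \<in> S \<and> q \<in> S \<and> p < q. D p q) = (\<Sum>(p, q) \<in> ?up \<union> ?down. D p q)"
    by (rule sum.mono_neutral_right) (use finP in \<open>auto intro!: D\<close>)
  also have "\<dots> = (\<Sum>(p, q) \<in> ?up. D p q) + (\<Sum>(p, q) \<in> ?down. D p q)"
    by (rule sum.union_disjoint) (use finP in auto)
  also have "(\<Sum>(p, q) \<in> ?down. D p q) = (\<Sum>(p, q) \<in> ?down. D q p) + (\<Sum>(p, q) \<in> ?down. E p q)"
    unfolding sum.distrib[symmetric]
  proof (rule sum.cong)
    fix x assume "x \<in> ?down"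
    then obtain p q where x: "x = (p, q)" "p \<in> S" "q \<in> S" by blast
    have "D p q = D q p + (D p q + D q p)"
      using char_2_add_self[OF ch, of "D q p"] by (simp add: algebra_simps)
    then show "(case x of (p, q) \<Rightarrow> D p q) =
        (case x of (p, q) \<Rightarrow> D q p) + (case x of (p, q) \<Rightarrow> E p q)"
      using E[OF x(2,3)] x(1) by simp
  qed simp
  also have "(\<Sum>(p, q) \<in> ?down. D q p) = (\<Sum>(p, q) \<in> ?down'. D p q)"
    by (rule sum.reindex_bij_witness[of _ prod.swap prod.swap]) auto
  also have "(\<Sum>(p, q) \<in> ?up. D p q) + ((\<Sum>(p, q) \<in> ?down'. D p q) + (\<Sum>(p, q) \<in> ?down. E p q)) =
      (\<Sum>(p, q) \<in> ?up \<union> ?down'. D p q) + (\<Sum>(p, q) \<in> ?down. E p q)"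
    unfolding add.assoc[symmetric]
    by (intro arg_cong2[of _ _ _ _ "(+)"] refl sum.union_disjoint[symmetric]) (use finP in auto)
  also have "?up \<union> ?down' = {(p, q). p \<in> S \<and> q \<in> S \<and> f p < f q}"
    by (auto simp: not_less_iff_gr_or_eq)
  finally show ?thesis .
qed

text \<open>These pairs are the cells of the entries in the tableau with word \<open>w\<close> that
  a column permutation produces from \<open>t\<close>.\<close>

lemma bij_word_col_of:
  assumes lam: "is_partition lam n" and t: "t \<in> tableaux lam" and w: "transversal lam w t"
  shows "bij_betw (\<lambda>p. (w p, col_of lam t p)) {1..sum_list lam} (cells lam)"
proof -
  let ?g = "\<lambda>p. (w p, col_of lam t p)"
  have inj: "inj_on ?g {1..sum_list lam}"
  proof (rule inj_onI)
    fix p q assume pq: "p \<in> {1..sum_list lam}" "q \<in> {1..sum_list lam}" "?g p = ?g q"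
    then have "q \<in> col_set lam t (col_of lam t p)"
      using mem_col_set_col_of[OF t pq(2)] by simp
    then show "p = q"
      using transversal_equal_entries[OF w mem_col_set_col_of[OF t pq(1)]] pq(3) by simp
  qed
  moreover have "?g ` {1..sum_list lam} = cells lam"
  proof (rule card_subset_eq)
    show "card (?g ` {1..sum_list lam}) = card (cells lam)"
      using card_image[OF inj] by (simp add: card_cells)
    show "?g ` {1..sum_list lam} \<subseteq> cells lam"
      using word_less_collen[OF w mem_col_set_col_of[OF t]] by (auto simp: mem_cells_collen[OF lam])
  qed simp
  ultimately show ?thesis by (simp add: bij_betw_def)
qed

text \<open>The cells strictly north-west of \<open>(i, j)\<close> form a full rectangle inside the
  diagram, of \<open>i * j\<close> cells since indices start at 0.\<close>

lemma card_northwest_pairs: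
  assumes lam: "is_partition lam n"
  shows "card {(x, y). x \<in> cells lam \<and> y \<in> cells lam \<and> fst x < fst y \<and> snd x < snd y} =
    (\<Sum>(i, j)\<in>cells lam. i * j)"
proof -
  have nw: "(i', j') \<in> cells lam" if "(i, j) \<in> cells lam" "i' < i" "j' < j" for i j i' j'
    using that rowlen_mono[OF lam, of i' i] by (simp add: mem_cells_rowlen)
  have "{(x, y). x \<in> cells lam \<and> y \<in> cells lam \<and> fst x < fst y \<and> snd x < snd y} =
      prod.swap ` (SIGMA y:cells lam. {..<fst y} \<times> {..<snd y})"
    by (auto simp: image_iff intro: nw)
  then have "card {(x, y). x \<in> cells lam \<and> y \<in> cells lam \<and> fst x < fst y \<and> snd x < snd y} =
      card (SIGMA y:cells lam. {..<fst y} \<times> {..<snd y})"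
    by (simp only: card_image[OF inj_swap])
  also have "\<dots> = (\<Sum>y\<in>cells lam. fst y * snd y)"
    by (simp add: card_cartesian_product)
  finally show ?thesis by (simp add: case_prod_beta)
qed

text \<open>Reading \<open>p\<close> as the cell \<open>(w p, col_of lam t p)\<close> turns these
  pairs into pairs of cells with one strictly north-west of the other.\<close>

lemma card_column_inversions:
  assumes lam: "is_partition lam n" and t: "t \<in> tableaux lam" and w: "transversal lam w t"
  shows "card {(a, b). a \<in> {1..sum_list lam} \<and> b \<in> {1..sum_list lam} \<and>
      col_of lam t a < col_of lam t b \<and> w a < w b} = (\<Sum>(i, j)\<in>cells lam. i * j)"
proof -
  let ?g = "\<lambda>p. (w p, col_of lam t p)" and ?S = "{1..sum_list lam}"
  have bij: "bij_betw ?g ?S (cells lam)" by (rule bij_word_col_of[OF assms])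
  have "bij_betw (map_prod ?g ?g)
      {(a, b). a \<in> ?S \<and> b \<in> ?S \<and> col_of lam t a < col_of lam t b \<and> w a < w b}
      {(x, y). x \<in> cells lam \<and> y \<in> cells lam \<and> fst x < fst y \<and> snd x < snd y}"
    unfolding bij_betw_def
  proof
    show "inj_on (map_prod ?g ?g)
        {(a, b). a \<in> ?S \<and> b \<in> ?S \<and> col_of lam t a < col_of lam t b \<and> w a < w b}"
      by (rule inj_on_subset[OF map_prod_inj_on[OF bij_betw_imp_inj_on bij_betw_imp_inj_on, OF bij bij]])
        auto
    show "map_prod ?g ?g ` {(a, b). a \<in> ?S \<and> b \<in> ?S \<and> col_of lam t a < col_of lam t b \<and> w a < w b} =
        {(x, y). x \<in> cells lam \<and> y \<in> cells lam \<and> fst x < fst y \<and> snd x < snd y}" (is "?L = ?R")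
    proof
      show "?L \<subseteq> ?R" using bij_betw_apply[OF bij] by auto
      show "?R \<subseteq> ?L"
      proof
        fix z assume "z \<in> ?R"
        then obtain x y where z: "z = (x, y)" "x \<in> cells lam" "y \<in> cells lam"
          "fst x < fst y" "snd x < snd y" by blast
        obtain a where a: "a \<in> ?S" "x = ?g a"
          using z(2) bij_betw_imp_surj_on[OF bij] by blast
        obtain b where b: "b \<in> ?S" "y = ?g b"
          using z(3) bij_betw_imp_surj_on[OF bij] by blast
        have "z = map_prod ?g ?g (a, b)" using z(1) a(2) b(2) by simp
        moreover have "col_of lam t a < col_of lam t b" "w a < w b"
          using z(4,5) a(2) b(2) by simp_all
        ultimately show "z \<in> ?L" using a(1) b(1) by blast
      qed
    qed
  qed
  then show ?thesis
    unfolding card_northwest_pairs[OF lam, symmetric] by (rule bij_betw_same_card)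
qed

lemma comp_transpose_conj:
  assumes "w \<circ> s = w" "bij s" "s \<circ> s = id"
  shows "w \<circ> transpose (s a) (s b) = w \<circ> transpose a b \<circ> s"
proof -
  have "s \<circ> transpose a b = transpose (s a) (s b) \<circ> s"
    using transpose_comp_eq[OF assms(2), of "s a" "s b"] bij_is_inj[OF assms(2)]
    by (simp add: inv_f_f)
  then have "s \<circ> transpose a b \<circ> s = transpose (s a) (s b)"
    using assms(3) by (simp add: comp_assoc)
  then have "w \<circ> transpose (s a) (s b) = (w \<circ> s) \<circ> transpose a b \<circ> s" by (simp add: comp_assoc)
  then show ?thesis using assms(1) by simp
qed

text \<open>If exchanging \<open>a\<close> and \<open>b\<close> makes \<open>w\<close> transversal,
  then \<open>w\<close> itself puts two entries \<open>a\<close> and \<open>a'\<close> of one column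
  in the same row. Every counted pair must touch one of the two to repair this, so exchanging
  \<open>a\<close> and \<open>a'\<close> pairs them off.\<close>

lemma even_card_swapped_inversions:
  assumes ch: "CHAR('f::field) = 2" and t: "t \<in> tableaux lam"
  shows "(of_nat (card {(a, b). a \<in> {1..sum_list lam} \<and> b \<in> {1..sum_list lam} \<and>
      col_of lam t a < col_of lam t b \<and> w a < w b \<and>
      transversal lam (w \<circ> transpose a b) t}) :: 'f) = 0" (is "of_nat (card ?R) = 0")
proof (cases "?R = {}")
  case False
  let ?S = "{1..sum_list lam}"
  obtain a b where ab: "a \<in> ?S" "b \<in> ?S" "col_of lam t a < col_of lam t b" "w a < w b"
    "transversal lam (w \<circ> transpose a b) t"
    using False by blast
  define j where "j = col_of lam t a"
  have aj: "a \<in> col_set lam t j" unfolding j_def by (rule mem_col_set_col_of[OF t ab(1)])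
  \<comment> \<open>After the exchange \<open>a\<close> carries the row \<open>w b\<close>. The
    smaller row \<open>w a\<close> must still occur in the same column, hence at another entry
    \<open>a'\<close>.\<close>
  have "w b < collen lam j" using word_less_collen[OF ab(5) aj] by simp
  then have "w a < collen lam j" using ab(4) by simp
  then obtain a' where a': "a' \<in> col_set lam t j" "(w \<circ> transpose a b) a' = w a"
    using transversal_obtain[OF ab(5)] by blast
  have "a' \<in> ?S" using a'(1) col_set_subset[OF t] by blast
  have "a' \<noteq> a" using a'(2) ab(4) by auto
  moreover have "a' \<noteq> b"
    using a'(1) col_of_eq_iff[OF t \<open>a' \<in> ?S\<close>, of j] ab(3) by (auto simp: j_def)
  ultimately have wa': "w a' = w a" using a'(2) by (simp add: transpose_def)
  define s where "s = transpose a a'"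
  have ws: "w \<circ> s = w" using wa' by (auto simp: s_def fun_eq_iff transpose_def)
  have ss: "s \<circ> s = id" "bij s" by (simp_all add: s_def)
  have sS: "s p \<in> ?S" if "p \<in> ?S" for p
    using that ab(1) \<open>a' \<in> ?S\<close> by (auto simp: s_def transpose_def)
  have cs: "col_of lam t (s p) = col_of lam t p" if "p \<in> ?S" for p
  proof -
    have "s p \<in> col_set lam t (col_of lam t p)"
      unfolding s_def
      by (rule bij_betw_apply[OF bij_transpose_col_set[OF t aj a'(1)] mem_col_set_col_of[OF t that]])
    then show ?thesis using col_of_eq_iff[OF t sS[OF that]] by blast
  qed
  have w_s: "w (s p) = w p" for p using fun_cong[OF ws, of p] by simp
  let ?h = "map_prod s s"
  show ?thesis
  proof (rule char_2_card_involution[OF ch, where h = ?h])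
    fix x assume "x \<in> ?R"
    then obtain p q where x: "x = (p, q)" "p \<in> ?S" "q \<in> ?S" "col_of lam t p < col_of lam t q"
      "w p < w q" "transversal lam (w \<circ> transpose p q) t" by blast
    have "transversal lam (w \<circ> transpose p q \<circ> s) t"
      unfolding s_def using transversal_transpose[OF t aj a'(1)] x(6) by blast
    then have "transversal lam (w \<circ> transpose (s p) (s q)) t"
      by (simp only: comp_transpose_conj[OF ws ss(2,1)])
    then show "?h x \<in> ?R" using x sS cs w_s by simp
    show "?h (?h x) = x" using x(1) by (simp add: s_def)
    show "?h x \<noteq> x"
    proof
      assume "?h x = x"
      then have "s p = p" "s q = q" using x(1) by simp_all
      \<comment> \<open>A fixed pair avoids \<open>a\<close> and \<open>a'\<close>, so its exchange
        would leave two equal rows in their column.\<close>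
      then have "p \<noteq> a" "p \<noteq> a'" "q \<noteq> a" "q \<noteq> a'"
        using \<open>a' \<noteq> a\<close> by (auto simp: s_def)
      then have "(w \<circ> transpose p q) a = (w \<circ> transpose p q) a'"
        using wa' by (simp add: transpose_def)
      then show False using transversal_equal_entries[OF x(6) aj a'(1)] \<open>a' \<noteq> a\<close> by simp
    qed
  qed
next
  case True
  then show ?thesis by (simp only: card.empty of_nat_0)
qed

text \<open>The pairs \<open>p < q\<close> are regrouped by the columns of \<open>t\<close>. A pair
  whose larger entry has the smaller column costs a vector \<open>e + act (transpose p q) e\<close>.
  The pairs ordered by column contribute the weight times the coefficient of \<open>e\<close>, while
  the swapped coefficients cancel in pairs.\<close>

lemma inversion_operator_polytabloid:
  fixes \<phi> :: "(tabloid \<Rightarrow> 'f::field) \<Rightarrow> 'f"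
  assumes ch: "CHAR('f) = 2" and lam: "is_partition lam n"
    and inv: "invariant_functional lam \<phi>" and t: "t \<in> tableaux lam"
  shows "\<exists>z\<in>specht lam. (\<forall>w\<in>words lam. coef lam z w =
      inversion_operator lam (coef lam (polytabloid lam t)) w) \<and>
    \<phi> z = of_nat (\<Sum>(i, j)\<in>cells lam. i * j) * \<phi> (polytabloid lam t)"
proof -
  let ?S = "{1..sum_list lam}" and ?e = "polytabloid lam t :: tabloid \<Rightarrow> 'f"
  let ?N = "\<Sum>(i, j)\<in>cells lam. i * j" and ?col = "col_of lam t"
  define Down where "Down = {(p, q). p \<in> ?S \<and> q \<in> ?S \<and> p < q \<and> ?col q < ?col p}"
  define y where "y = (\<lambda>(p, q). ?e + act (transpose p q) ?e)"
  define z where "z = fscale (of_nat ?N) ?e + (\<Sum>x\<in>Down. y x)"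
  have e: "?e \<in> specht lam" by (rule polytabloid_in_specht[OF t])
  have perm: "transpose p q permutes ?S" if "p \<in> ?S" "q \<in> ?S" for p q
    by (rule permutes_swap_id[OF that])
  have y: "y x \<in> specht lam" "\<phi> (y x) = 0" if x: "x \<in> Down" for x
  proof -
    obtain p q where pq: "x = (p, q)" "p \<in> ?S" "q \<in> ?S" using x by (auto simp: Down_def)
    have a: "act (transpose p q) ?e \<in> specht lam" by (rule specht_act[OF perm[OF pq(2,3)] e])
    show "y x \<in> specht lam" unfolding y_def pq(1) prod.case by (rule specht_add[OF e a])
    have "\<phi> (y x) = \<phi> ?e + \<phi> ?e"
      unfolding y_def pq(1) prod.case
      by (simp only: invariant_functional_add[OF inv e a] invariant_functional_act[OF inv perm[OF pq(2,3)] e])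
    then show "\<phi> (y x) = 0" by (simp only: char_2_add_self[OF ch])
  qed
  have sy: "(\<Sum>x\<in>Down. y x) \<in> specht lam" by (intro specht_sum y)
  have z: "z \<in> specht lam" unfolding z_def by (intro specht_add specht_fscale e sy)
  have "\<phi> z = of_nat ?N * \<phi> ?e + \<phi> (\<Sum>x\<in>Down. y x)"
    unfolding z_def
    by (simp only: invariant_functional_add[OF inv specht_fscale[OF e] sy]
        invariant_functional_fscale[OF inv e])
  also have "\<phi> (\<Sum>x\<in>Down. y x) = (\<Sum>x\<in>Down. \<phi> (y x))"
    by (rule invariant_functional_sum[OF inv y(1)])
  also have "\<dots> = 0" using y(2) by simp
  finally have phi: "\<phi> z = of_nat ?N * \<phi> ?e" by simp
  have "coef lam z w = inversion_operator lam (coef lam ?e) w" if w: "w \<in> words lam" for w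
  proof -
    define c where "c = coef lam ?e"
    have c: "c u = of_bool (transversal lam u t)" if "u \<in> words lam" for u
      unfolding c_def by (rule coef_polytabloid[OF ch lam t that])
    have wt: "w \<circ> transpose p q \<in> words lam" if "p \<in> ?S" "q \<in> ?S" for p q
      by (rule words_comp[OF w perm[OF that]])
    define D where "D = (\<lambda>p q. if w p < w q then c w + c (w \<circ> transpose p q) else 0)"
    define E where "E = (\<lambda>p q. c w + c (w \<circ> transpose p q))"
    have "inversion_operator lam c w = (\<Sum>(p, q) | p \<in> ?S \<and> q \<in> ?S \<and> p < q. D p q)"
      by (simp only: inversion_operator_def D_def)
    also have "\<dots> = (\<Sum>(p, q) | p \<in> ?S \<and> q \<in> ?S \<and> ?col p < ?col q. D p q) +
        (\<Sum>(p, q) | p \<in> ?S \<and> q \<in> ?S \<and> p < q \<and> ?col q < ?col p. E p q)"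
    proof (rule sum_pairs_resort[OF ch])
      fix p q assume pq: "p \<in> ?S" "q \<in> ?S"
      show "D p q + D q p = E p q"
      proof (cases "w p = w q")
        case True
        then have "w \<circ> transpose p q = w" by (auto simp: fun_eq_iff transpose_def)
        then show ?thesis using True char_2_add_self[OF ch] by (simp add: D_def E_def)
      next
        case False
        then consider "w p < w q" "\<not> w q < w p" | "w q < w p" "\<not> w p < w q" by linarith
        then show ?thesis by cases (simp_all add: D_def E_def transpose_commute[of q p])
      qed
      assume "?col p = ?col q"
      then have "p \<in> col_set lam t (?col p)" "q \<in> col_set lam t (?col p)"
        using mem_col_set_col_of[OF t pq(1)] mem_col_set_col_of[OF t pq(2)] by simp_all
      then have "c (w \<circ> transpose p q) = c w"
        using c[OF wt[OF pq]] c[OF w] transversal_transpose[OF t] by simp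
      then show "D p q = 0" using char_2_add_self[OF ch] by (simp add: D_def)
    qed simp
    also have "(\<Sum>(p, q) | p \<in> ?S \<and> q \<in> ?S \<and> p < q \<and> ?col q < ?col p. E p q) =
        coef lam (\<Sum>x\<in>Down. y x) w"
      unfolding coef_sum Down_def[symmetric]
    proof (rule sum.cong)
      fix x assume "x \<in> Down"
      then obtain p q where pq: "x = (p, q)" "p \<in> ?S" "q \<in> ?S" by (auto simp: Down_def)
      show "(case x of (p, q) \<Rightarrow> E p q) = coef lam (y x) w"
        unfolding pq(1) y_def prod.case coef_add coef_act[OF w perm[OF pq(2,3)]] E_def c_def ..
    qed simp
    also have "(\<Sum>(p, q) | p \<in> ?S \<and> q \<in> ?S \<and> ?col p < ?col q. D p q) = of_nat ?N * c w"
    proof -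
      define Q where "Q = {(a, b). a \<in> ?S \<and> b \<in> ?S \<and> ?col a < ?col b \<and> w a < w b}"
      have finS: "finite (?S \<times> ?S)" by simp
      have finQ: "finite Q"
        by (rule finite_subset[OF _ finS]) (auto simp: Q_def)
      have "(\<Sum>(p, q) | p \<in> ?S \<and> q \<in> ?S \<and> ?col p < ?col q. D p q) = (\<Sum>(p, q)\<in>Q. D p q)"
      proof (rule sum.mono_neutral_right)
        show "finite {(p, q). p \<in> ?S \<and> q \<in> ?S \<and> ?col p < ?col q}"
          by (rule finite_subset[OF _ finS]) auto
      qed (auto simp: Q_def D_def split: if_splits)
      also have "\<dots> = (\<Sum>x\<in>Q. c w + of_bool (transversal lam (w \<circ> transpose (fst x) (snd x)) t))"
        by (rule sum.cong) (auto simp: Q_def D_def c wt)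
      also have "\<dots> = of_nat (card Q) * c w +
          of_nat (card {x \<in> Q. transversal lam (w \<circ> transpose (fst x) (snd x)) t})"
        using finQ by (simp add: sum.distrib of_bool_def sum.If_cases Int_def)
      also have "{x \<in> Q. transversal lam (w \<circ> transpose (fst x) (snd x)) t} =
          {(a, b). a \<in> ?S \<and> b \<in> ?S \<and> ?col a < ?col b \<and> w a < w b \<and>
            transversal lam (w \<circ> transpose a b) t}"
        by (auto simp: Q_def)
      also have "(of_nat (card \<dots>) :: 'f) = 0"
        by (rule even_card_swapped_inversions[OF ch t])
      \<comment> \<open>The size of \<open>Q\<close> is known only for transversal \<open>w\<close>;
        otherwise \<open>c w\<close> is 0.\<close>
      also have "of_nat (card Q) * c w = of_nat ?N * c w"
        using card_column_inversions[OF lam t, of w] c[OF w]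
        by (cases "transversal lam w t") (simp_all add: Q_def)
      finally show ?thesis by simp
    qed
    also have "of_nat ?N * c w + coef lam (\<Sum>x\<in>Down. y x) w = coef lam z w"
      unfolding z_def coef_add coef_fscale c_def ..
    finally show ?thesis unfolding c_def ..
  qed
  then show ?thesis using z phi by blast
qed

lemma inversion_operator_linear:
  "inversion_operator lam (coef lam (fscale c x + y)) w =
    c * inversion_operator lam (coef lam x) w + inversion_operator lam (coef lam y) w"
  unfolding inversion_operator_def coef_add coef_fscale sum_distrib_left sum.distrib[symmetric]
  by (rule sum.cong) (auto simp: algebra_simps)

text \<open>The operator lives on coefficient functions, so \<open>z\<close> stands for the vector
  of the Specht module with the resulting coefficients. Linearity extends the case of
  polytabloids.\<close>

lemma inversion_operator_specht:
  fixes \<phi> :: "(tabloid \<Rightarrow> 'f::field) \<Rightarrow> 'f"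
  assumes ch: "CHAR('f) = 2" and lam: "is_partition lam n"
    and inv: "invariant_functional lam \<phi>" and x: "x \<in> specht lam"
  shows "\<exists>z\<in>specht lam. (\<forall>w\<in>words lam. coef lam z w = inversion_operator lam (coef lam x) w) \<and>
    \<phi> z = of_nat (\<Sum>(i, j)\<in>cells lam. i * j) * \<phi> x"
  using x
proof (induction rule: specht_induct)
  case zero
  have "coef lam 0 w = inversion_operator lam (coef lam (0 :: tabloid \<Rightarrow> 'f)) w" for w
    unfolding inversion_operator_def coef_zero by (rule sum.neutral[symmetric]) auto
  then show ?case
    using specht_zero invariant_functional_zero[OF inv] mult_zero_right by metis
next
  case (add x y c)
  obtain z where z: "z \<in> specht lam"
    "\<And>w. w \<in> words lam \<Longrightarrow> coef lam z w = inversion_operator lam (coef lam x) w"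
    "\<phi> z = of_nat (\<Sum>(i, j)\<in>cells lam. i * j) * \<phi> x"
    using add.IH(1) by blast
  obtain z' where z': "z' \<in> specht lam"
    "\<And>w. w \<in> words lam \<Longrightarrow> coef lam z' w = inversion_operator lam (coef lam y) w"
    "\<phi> z' = of_nat (\<Sum>(i, j)\<in>cells lam. i * j) * \<phi> y"
    using add.IH(2) by blast
  show ?case
  proof (intro bexI[of _ "fscale c z + z'"] conjI ballI)
    show "fscale c z + z' \<in> specht lam" by (intro specht_add specht_fscale z(1) z'(1))
    show "coef lam (fscale c z + z') w = inversion_operator lam (coef lam (fscale c x + y)) w"
      if "w \<in> words lam" for w
      unfolding inversion_operator_linear coef_add coef_fscale z(2)[OF that] z'(2)[OF that] ..
    have 1: "\<phi> (fscale c z + z') = c * \<phi> z + \<phi> z'"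
      by (simp only: invariant_functional_add[OF inv specht_fscale[OF z(1)] z'(1)]
          invariant_functional_fscale[OF inv z(1)])
    have 2: "\<phi> (fscale c x + y) = c * \<phi> x + \<phi> y"
      by (simp only: invariant_functional_add[OF inv specht_fscale[OF add.hyps(1)] add.hyps(2)]
          invariant_functional_fscale[OF inv add.hyps(1)])
    show "\<phi> (fscale c z + z') = of_nat (\<Sum>(i, j)\<in>cells lam. i * j) * \<phi> (fscale c x + y)"
      unfolding 1 2 z(3) z'(3) by (simp only: algebra_simps)
  qed
next
  case (polytabloid t)
  show ?case by (rule inversion_operator_polytabloid[OF ch lam inv polytabloid])
qed

text \<open>The image of \<open>v\<close> vanishes, so applying \<open>\<phi>\<close> to it leaves
  the weight times \<open>\<phi> v = 1\<close> equal to 0 in the field.\<close>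

lemma even_cell_weight:
  fixes \<phi> :: "(tabloid \<Rightarrow> 'f::field) \<Rightarrow> 'f"
  assumes ch: "CHAR('f) = 2" and lam: "is_partition lam n"
    and inv: "invariant_functional lam \<phi>"
    and v: "v \<in> specht lam" "\<And>w. w \<in> words lam \<Longrightarrow> coef lam v w = 1" "\<phi> v = 1"
  shows "even (\<Sum>(i, j)\<in>cells lam. i * j)"
proof -
  obtain z where z: "z \<in> specht lam"
    "\<And>w. w \<in> words lam \<Longrightarrow> coef lam z w = inversion_operator lam (coef lam v) w"
    "\<phi> z = of_nat (\<Sum>(i, j)\<in>cells lam. i * j) * \<phi> v"
    using inversion_operator_specht[OF ch lam inv v(1)] by blast
  have "z = 0"
  proof (rule specht_eqI[OF z(1) specht_zero])
    fix w assume w: "w \<in> words lam"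
    have "coef lam v w + coef lam v (w \<circ> transpose p q) = 0"
      if "p \<in> {1..sum_list lam}" "q \<in> {1..sum_list lam}" for p q
      using v(2)[OF w] v(2)[OF words_comp[OF w permutes_swap_id[OF that]]]
        char_2_add_self[OF ch, of 1] by simp
    then have "inversion_operator lam (coef lam v) w = 0"
      unfolding inversion_operator_def by (intro sum.neutral) auto
    then show "coef lam z w = coef lam 0 w" using z(2)[OF w] by (simp only: coef_zero)
  qed
  then have "of_nat (\<Sum>(i, j)\<in>cells lam. i * j) = (0 :: 'f)"
    using z(3) v(3) invariant_functional_zero[OF inv] by simp
  then show ?thesis unfolding char_2_of_nat[OF ch] by simp
qed

section \<open>One-dimensional summands\<close>

lemma mem_span_singleton: "x \<in> fvs.span {u} \<longleftrightarrow> (\<exists>c. x = fscale c u)"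
  by (auto simp: fvs.span_singleton)

lemma act_transpose_involutory:
  assumes "p \<in> {1..sum_list lam}" "q \<in> {1..sum_list lam}"
  shows "act (transpose p q) (act (transpose p q) u) = u"
proof -
  have "inv (transpose p q) = transpose p q" by (rule inv_equality) auto
  then show ?thesis
    using act_tabloid_inv(1)[OF permutes_swap_id[OF assms]] by (simp add: act_def)
qed

lemma char_2_square_eq_1:
  assumes "CHAR('f::field) = 2" "(c :: 'f) * c = 1"
  shows "c = 1"
proof -
  have "(c - 1) * (c + 1) = 0" using assms(2) by (simp add: algebra_simps)
  then have "c = 1 \<or> c = - 1" by (auto simp: eq_neg_iff_add_eq_0)
  then show ?thesis using uminus_CHAR_2[OF assms(1), of 1] by simp
qed

lemma words_transitive:
  assumes "w \<in> words lam" "w' \<in> words lam"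
  obtains p where "p permutes {1..sum_list lam}" "w' = w \<circ> p"
proof -
  obtain t t' where t: "t \<in> tableaux lam" "w = row_word lam t"
    and t': "t' \<in> tableaux lam" "w' = row_word lam t'"
    using assms by (auto simp: words_def)
  obtain p where p: "p permutes {1..sum_list lam}" "t' = p \<circ> t"
    using tableaux_transitive[OF t(1) t'(1)] .
  show thesis
    by (rule that[OF permutes_inv[OF p(1)]]) (simp only: t'(2) p(2) row_word_comp[OF t(1) p(1)] t(2))
qed

text \<open>
  A transposition acts on a line by a scalar whose square is 1, hence trivially in characteristic 2.
\<close>

lemma line_fixed_pointwise:
  fixes u :: "tabloid \<Rightarrow> 'f::field"
  assumes ch: "CHAR('f) = 2" and U: "submodule lam U" and u: "u \<in> U" "u \<noteq> 0" "U \<subseteq> fvs.span {u}"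
    and w: "w \<in> words lam" and p: "p permutes {1..sum_list lam}"
  shows "coef lam u (w \<circ> p) = coef lam u w"
proof -
  let ?S = "{1..sum_list lam}"
  have tr: "coef lam u (w' \<circ> transpose a b) = coef lam u w'"
    if "a \<in> ?S" "b \<in> ?S" "w' \<in> words lam" for a b w'
  proof -
    let ?t = "transpose a b"
    have perm: "?t permutes ?S" by (rule permutes_swap_id[OF that(1,2)])
    then have "act ?t u \<in> U" using U u(1) by (simp add: submodule_def)
    then obtain c where c: "act ?t u = fscale c u" using u(3) mem_span_singleton by blast
    have "u = act ?t (act ?t u)" by (rule act_transpose_involutory[OF that(1,2), symmetric])
    also have "\<dots> = fscale (c * c) u"
      unfolding c act_fscale by (simp add: fscale_def mult.assoc)
    finally have uc: "u = fscale (c * c) u" .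
    obtain X where "u X \<noteq> 0" using u(2) by (auto simp: fun_eq_iff)
    moreover have "u X = c * c * u X" using fun_cong[OF uc, of X] by (simp add: fscale_def)
    ultimately have "c * c = 1" by simp
    then have "c = 1" by (rule char_2_square_eq_1[OF ch])
    then have "act ?t u = u" using c by (simp add: fscale_def)
    then show ?thesis using coef_act[OF that(3) perm, of u] by simp
  qed
  \<comment> \<open>The claim is made for all words at once, because the induction step uses it at
    \<open>w \<circ> transpose a b\<close>.\<close>
  have "\<forall>w\<in>words lam. coef lam u (w \<circ> p) = coef lam u w"
  proof (rule permutes_induct[OF p])
    fix a b q
    assume ab: "a \<in> ?S" "b \<in> ?S" and IH: "\<forall>w\<in>words lam. coef lam u (w \<circ> q) = coef lam u w"
    show "\<forall>w\<in>words lam. coef lam u (w \<circ> (transpose a b \<circ> q)) = coef lam u w"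
    proof
      fix w assume w: "w \<in> words lam"
      have "coef lam u (w \<circ> transpose a b \<circ> q) = coef lam u (w \<circ> transpose a b)"
        using IH words_comp[OF w permutes_swap_id[OF ab]] by blast
      then show "coef lam u (w \<circ> (transpose a b \<circ> q)) = coef lam u w"
        using tr[OF ab w] by (simp only: comp_assoc)
    qed
  qed simp_all
  then show ?thesis using w by blast
qed

lemma one_dim_summand_imp_functional:
  assumes ch: "CHAR('f::field) = 2"
    and "has_one_dim_summand lam (specht lam :: (tabloid \<Rightarrow> 'f) set)"
  shows "\<exists>\<phi> v. invariant_functional lam \<phi> \<and> (v :: tabloid \<Rightarrow> 'f) \<in> specht lam \<and>
    (\<forall>w\<in>words lam. coef lam v w = 1) \<and> \<phi> v = 1"
proof -
  obtain U W :: "(tabloid \<Rightarrow> 'f) set" where U: "submodule lam U" and W: "submodule lam W"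
    and UW: "U \<inter> W = {0}" and V: "specht lam = {u + w | u w. u \<in> U \<and> w \<in> W}"
    and dimU: "fvs.dim U = 1"
    using assms(2) unfolding has_one_dim_summand_def by blast
  have sU: "fvs.subspace U" and sW: "fvs.subspace W" and UP: "U \<subseteq> perm_module lam"
    using U W by (simp_all add: submodule_def)
  obtain B where B: "B \<subseteq> U" "\<not> fvs.dependent B" "U \<subseteq> fvs.span B" "card B = fvs.dim U"
    using fvs.basis_exists .
  then obtain u where Bu: "B = {u}" using dimU by (auto simp: card_1_singleton_iff)
  have u: "u \<in> U" "u \<noteq> 0" "U \<subseteq> fvs.span {u}" using B Bu by auto
  obtain w0 where w0: "w0 \<in> words lam"
    using tableaux_nonempty[of lam] by (auto simp: words_def)
  define c0 where "c0 = coef lam u w0"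
  have const: "coef lam u w = c0" if w: "w \<in> words lam" for w
  proof -
    obtain p where "p permutes {1..sum_list lam}" "w = w0 \<circ> p"
      using words_transitive[OF w0 w] .
    then show ?thesis unfolding c0_def using line_fixed_pointwise[OF ch U u w0] by blast
  qed
  have c0: "c0 \<noteq> 0"
  proof
    assume "c0 = 0"
    have "u = 0"
    proof (rule perm_module_eqI)
      show "u \<in> perm_module lam" using UP u(1) by blast
      show "0 \<in> perm_module lam" unfolding perm_module_def by (rule fvs.span_zero)
      fix w assume "w \<in> words lam"
      then show "coef lam u w = coef lam 0 w" using const \<open>c0 = 0\<close> by (simp only: coef_zero)
    qed
    then show False using u(2) by blast
  qed
  define v where "v = fscale (inverse c0) u"
  have vU: "v \<in> U" unfolding v_def by (rule fvs.subspace_scale[OF sU u(1)])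
  have v1: "coef lam v w = 1" if "w \<in> words lam" for w
    unfolding v_def coef_fscale const[OF that] using c0 by simp
  have Uv: "\<exists>c. x = fscale c v" if x: "x \<in> U" for x
  proof -
    obtain c where "x = fscale c u" using x u(3) mem_span_singleton by blast
    then have "x = fscale (c * c0) v"
      unfolding v_def fvs.scale_scale using c0 by simp
    then show ?thesis ..
  qed
  have vS: "v \<in> specht lam"
  proof -
    have "v = v + 0" by (rule add_0_right[symmetric])
    then show ?thesis unfolding V using vU fvs.subspace_0[OF sW] by blast
  qed
  have WS: "w \<in> specht lam" if "w \<in> W" for w
  proof -
    have "w = 0 + w" by (rule add_0_left[symmetric])
    then show ?thesis unfolding V using that fvs.subspace_0[OF sU] by blast
  qed
  have "\<forall>x\<in>specht lam. \<exists>c. \<exists>w\<in>W. x = fscale c v + w"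
    unfolding V using Uv by blast
  then obtain \<phi> where \<phi>: "\<And>x. x \<in> specht lam \<Longrightarrow> \<exists>w\<in>W. x = fscale (\<phi> x) v + w" by metis
  \<comment> \<open>\<open>\<phi>\<close> was obtained by choice, so its linearity, invariance and
    normalisation all come from the uniqueness of the decomposition.\<close>
  have uniq: "\<phi> x = c" if x: "x = fscale c v + w" "w \<in> W" for x c w
  proof -
    have "x \<in> specht lam" unfolding x(1) by (intro specht_add specht_fscale vS WS x(2))
    then obtain w' where w': "w' \<in> W" "x = fscale (\<phi> x) v + w'" using \<phi> by blast
    have eq: "fscale (\<phi> x - c) v = w - w'"
    proof
      fix X
      have "fscale (\<phi> x) v X + w' X = fscale c v X + w X"
        using w'(2) x(1) by (metis plus_fun_apply)
      then show "fscale (\<phi> x - c) v X = (w - w') X" by (simp add: fscale_def algebra_simps)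
    qed
    have "w - w' \<in> W" by (rule fvs.subspace_diff[OF sW x(2) w'(1)])
    moreover have "w - w' \<in> U" unfolding eq[symmetric] by (rule fvs.subspace_scale[OF sU vU])
    ultimately have "w - w' \<in> U \<inter> W" by (intro IntI)
    then have "fscale (\<phi> x - c) v = 0" unfolding UW eq by (rule singletonD)
    then have "(\<phi> x - c) * coef lam v w0 = 0" by (simp only: coef_fscale[symmetric] coef_zero)
    then show ?thesis using v1[OF w0] by simp
  qed
  have v_act: "act p v = v" if p: "p permutes {1..sum_list lam}" for p
  proof (rule specht_eqI[OF specht_act[OF p vS] vS])
    fix w assume w: "w \<in> words lam"
    show "coef lam (act p v) w = coef lam v w"
      by (simp only: coef_act[OF w p] v1[OF w] v1[OF words_comp[OF w p]])
  qed
  have "invariant_functional lam \<phi>"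
    unfolding invariant_functional_def
  proof (intro conjI ballI allI impI)
    fix x y :: "tabloid \<Rightarrow> 'f" assume "x \<in> specht lam" "y \<in> specht lam"
    then obtain a b where ab: "a \<in> W" "b \<in> W" "x = fscale (\<phi> x) v + a" "y = fscale (\<phi> y) v + b"
      using \<phi> by metis
    show "\<phi> (x + y) = \<phi> x + \<phi> y"
    proof (rule uniq)
      show "x + y = fscale (\<phi> x + \<phi> y) v + (a + b)"
        by (subst ab(3), subst ab(4)) (simp add: fscale_def fun_eq_iff algebra_simps)
      show "a + b \<in> W" by (rule fvs.subspace_add[OF sW ab(1,2)])
    qed
  next
    fix c and x :: "tabloid \<Rightarrow> 'f" assume "x \<in> specht lam"
    then obtain a where a: "a \<in> W" "x = fscale (\<phi> x) v + a" using \<phi> by metis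
    show "\<phi> (fscale c x) = c * \<phi> x"
    proof (rule uniq)
      show "fscale c x = fscale (c * \<phi> x) v + fscale c a"
        by (subst a(2)) (simp add: fscale_def fun_eq_iff algebra_simps)
      show "fscale c a \<in> W" by (rule fvs.subspace_scale[OF sW a(1)])
    qed
  next
    fix p and x :: "tabloid \<Rightarrow> 'f"
    assume p: "p permutes {1..sum_list lam}" and "x \<in> specht lam"
    then obtain a where a: "a \<in> W" "x = fscale (\<phi> x) v + a" using \<phi> by metis
    show "\<phi> (act p x) = \<phi> x"
    proof (rule uniq)
      have "act p (fscale (\<phi> x) v + a) = fscale (\<phi> x) v + act p a"
        by (simp only: act_add act_fscale v_act[OF p])
      then show "act p x = fscale (\<phi> x) v + act p a" using a(2) by metis
      show "act p a \<in> W" using W p a(1) by (simp add: submodule_def)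
    qed
  qed
  moreover have "\<phi> v = 1"
  proof (rule uniq)
    show "v = fscale 1 v + 0" by (simp add: fscale_def fun_eq_iff)
    show "0 \<in> W" by (rule fvs.subspace_0[OF sW])
  qed
  ultimately show ?thesis using vS v1 by blast
qed

text \<open>The complement is the kernel of \<open>\<phi>\<close>. The normalisation
  \<open>\<phi> v = 1\<close> makes the kernel meet the line of \<open>v\<close> in 0 only and puts
  \<open>x + fscale (- \<phi> x) v\<close> into it.\<close>

lemma functional_imp_one_dim_summand:
  fixes v :: "tabloid \<Rightarrow> 'f::field"
  assumes inv: "invariant_functional lam \<phi>" and v: "v \<in> specht lam"
    and v1: "\<And>w. w \<in> words lam \<Longrightarrow> coef lam v w = 1" and phi: "\<phi> v = 1"
  shows "has_one_dim_summand lam (specht lam :: (tabloid \<Rightarrow> 'f) set)"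
proof -
  have v_act: "act p v = v" if p: "p permutes {1..sum_list lam}" for p
  proof (rule specht_eqI[OF specht_act[OF p v] v])
    fix w assume w: "w \<in> words lam"
    show "coef lam (act p v) w = coef lam v w"
      by (simp only: coef_act[OF w p] v1[OF w] v1[OF words_comp[OF w p]])
  qed
  define U where "U = fvs.span {v}"
  define W where "W = {x \<in> specht lam. \<phi> x = 0}"
  have v0: "v \<noteq> 0"
  proof
    assume "v = 0"
    then have "\<phi> v = 0" using invariant_functional_zero[OF inv] by metis
    then show False using phi by simp
  qed
  have US: "U \<subseteq> specht lam"
    unfolding U_def by (rule fvs.span_minimal) (use v in \<open>simp_all add: specht_def\<close>)
  have "submodule lam U"
    unfolding submodule_def
  proof (intro conjI allI impI ballI)
    show "U \<subseteq> perm_module lam" using US specht_subset by blast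
    show "fvs.subspace U" unfolding U_def by (rule fvs.subspace_span)
    fix p u assume p: "p permutes {1..sum_list lam}" and "u \<in> U"
    then obtain c where "u = fscale c v" unfolding U_def mem_span_singleton by blast
    then have "act p u = fscale c v" by (simp only: act_fscale v_act[OF p])
    then show "act p u \<in> U" unfolding U_def mem_span_singleton by blast
  qed
  moreover have "submodule lam W"
    unfolding submodule_def
  proof (intro conjI allI impI ballI)
    show "W \<subseteq> perm_module lam" using specht_subset by (auto simp: W_def)
    show "fvs.subspace W"
    proof (rule fvs.subspaceI)
      show "0 \<in> W" unfolding W_def using specht_zero invariant_functional_zero[OF inv] by blast
      show "x + y \<in> W" if "x \<in> W" "y \<in> W" for x y
        using that specht_add[of x lam y] invariant_functional_add[OF inv, of x y]
        unfolding W_def mem_Collect_eq by (metis add_0_left)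
      show "fscale c x \<in> W" if "x \<in> W" for c x
        using that specht_fscale[of x lam c] invariant_functional_fscale[OF inv, of x c]
        unfolding W_def mem_Collect_eq by (metis mult_zero_right)
    qed
    fix p x assume p: "p permutes {1..sum_list lam}" and x: "x \<in> W"
    then show "act p x \<in> W"
      using specht_act[OF p, of x] invariant_functional_act[OF inv p, of x]
      unfolding W_def mem_Collect_eq by metis
  qed
  moreover have "U \<inter> W = {0}"
  proof -
    have "x = 0" if "x \<in> U" "x \<in> W" for x :: "tabloid \<Rightarrow> 'f"
    proof -
      obtain c where c: "x = fscale c v" using \<open>x \<in> U\<close> unfolding U_def mem_span_singleton by blast
      have "\<phi> x = c * 1" unfolding c phi[symmetric] by (rule invariant_functional_fscale[OF inv v])
      then have "c = 0" using \<open>x \<in> W\<close> by (simp add: W_def)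
      then show ?thesis using c by (simp only: fvs.scale_zero_left)
    qed
    moreover have "0 \<in> U" "0 \<in> W"
      unfolding U_def W_def using fvs.span_zero specht_zero invariant_functional_zero[OF inv] by blast+
    ultimately show ?thesis by blast
  qed
  moreover have "specht lam = {u + w | u w. u \<in> U \<and> w \<in> W}"
  proof
    show "{u + w | u w. u \<in> U \<and> w \<in> W} \<subseteq> specht lam"
      using US specht_add by (fastforce simp only: W_def)
    show "specht lam \<subseteq> {u + w | u w. u \<in> U \<and> w \<in> W}"
    proof
      fix x :: "tabloid \<Rightarrow> 'f" assume x: "x \<in> specht lam"
      have "fscale (\<phi> x) v \<in> U" unfolding U_def mem_span_singleton by blast
      moreover have "x + fscale (- \<phi> x) v \<in> W"
      proof -
        have "\<phi> (x + fscale (- \<phi> x) v) = \<phi> x + - \<phi> x * \<phi> v"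
          by (simp only: invariant_functional_add[OF inv x specht_fscale[OF v]]
              invariant_functional_fscale[OF inv v])
        then have "\<phi> (x + fscale (- \<phi> x) v) = 0" using phi by simp
        then show ?thesis unfolding W_def using specht_add[OF x specht_fscale[OF v]] by blast
      qed
      moreover have "x = fscale (\<phi> x) v + (x + fscale (- \<phi> x) v)"
        by (simp add: fscale_def fun_eq_iff)
      ultimately show "x \<in> {u + w | u w. u \<in> U \<and> w \<in> W}" by blast
    qed
  qed
  moreover have "fvs.dim U = 1"
    unfolding U_def using fvs.dim_span_eq_card_independent[of "{v}"] v0 by simp
  ultimately show ?thesis unfolding has_one_dim_summand_def by blast
qed

text \<open>A single row admits only one tabloid, so the dimension hypothesis of the theorem leaves
  at least two rows.\<close>

lemma dim_specht_single_row:
  assumes "length lam \<le> 1"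
  shows "fvs.dim (specht lam :: (tabloid \<Rightarrow> 'f::field) set) \<le> 1"
proof -
  have "w = (\<lambda>_. 0)" if w: "w \<in> words lam" for w
  proof -
    obtain t where t: "t \<in> tableaux lam" "w = row_word lam t"
      using w by (auto simp: words_def)
    show ?thesis
      unfolding t(2) by (rule row_word_eqI[OF t(1)]) (use assms in \<open>auto simp: cells_def\<close>)
  qed
  then have sub: "tabloids lam \<subseteq> {tabloid_of_word lam (\<lambda>_. 0)}" by (auto simp: tabloids_eq)
  have "fvs.dim (specht lam :: (tabloid \<Rightarrow> 'f) set) \<le>
      card (basis_vec ` tabloids lam :: (tabloid \<Rightarrow> 'f) set)"
    by (rule fvs.dim_le_card)
      (use specht_subset[of lam] finite_subset[OF sub] in \<open>auto simp: perm_module_def\<close>)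
  also have "\<dots> \<le> card (tabloids lam)"
    by (rule card_image_le) (rule finite_subset[OF sub], simp)
  also have "\<dots> \<le> 1" using card_mono[OF _ sub] by simp
  finally show ?thesis .
qed

text \<open>With a single column all tableaux have the same column set, and in characteristic 2 this
  determines the polytabloid, so all of them coincide.\<close>

lemma dim_specht_single_column:
  assumes ch: "CHAR('f::field) = 2" and lam: "is_partition lam n" and "rowlen lam 0 \<le> 1"
  shows "fvs.dim (specht lam :: (tabloid \<Rightarrow> 'f) set) \<le> 1"
proof -
  have "snd c = 0" if "c \<in> cells lam" for c
    using that rowlen_mono[OF lam, of 0 "fst c"] assms(3) by (cases c) (simp add: mem_cells_rowlen)
  then have col: "{c \<in> cells lam. snd c = j} = (if j = 0 then cells lam else {})" for j
    by auto
  have C: "col_set lam t j = (if j = 0 then {1..sum_list lam} else {})"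
    if "t \<in> tableaux lam" for t j
    unfolding col_set_def col using tableaux_image[OF that] by simp
  obtain t0 where t0: "t0 \<in> tableaux lam" using tableaux_nonempty by blast
  have "polytabloid lam t = (polytabloid lam t0 :: tabloid \<Rightarrow> 'f)" if t: "t \<in> tableaux lam" for t
  proof (rule specht_eqI[OF polytabloid_in_specht[OF t] polytabloid_in_specht[OF t0]])
    fix w assume w: "w \<in> words lam"
    show "coef lam (polytabloid lam t) w = (coef lam (polytabloid lam t0) w :: 'f)"
      by (simp only: coef_polytabloid[OF ch lam t w] coef_polytabloid[OF ch lam t0 w]
          transversal_def C[OF t] C[OF t0])
  qed
  then have "polytabloid lam ` tableaux lam \<subseteq> {polytabloid lam t0 :: tabloid \<Rightarrow> 'f}" by blast
  then have "specht lam \<subseteq> fvs.span {polytabloid lam t0 :: tabloid \<Rightarrow> 'f}"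
    unfolding specht_def by (rule fvs.span_mono)
  then have "fvs.dim (specht lam :: (tabloid \<Rightarrow> 'f) set) \<le> card {polytabloid lam t0 :: tabloid \<Rightarrow> 'f}"
    by (rule fvs.dim_le_card) simp
  then show ?thesis by simp
qed

section \<open>Hooks\<close>

lemma even_choose_two:
  assumes "odd a" "even ((a + 2) choose 2)"
  shows "a mod 4 = 3"
proof (rule ccontr)
  assume "a mod 4 \<noteq> 3"
  then have "a mod 4 = 1" using assms(1) by presburger
  then obtain q where q: "a = 4 * q + 1" by (metis mult_div_mod_eq)
  have "(a + 2) choose 2 = (4 * q + 3) * (2 * q + 1)"
    unfolding choose_two q by (simp add: algebra_simps)
  then show False using assms(2) by simp
qed

lemma odd_sum_lessThan:
  assumes "(a::nat) mod 4 = 3"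
  shows "odd (\<Sum>j<a. j)"
proof -
  obtain q where q: "a = 4 * q + 3" using assms by (metis mult_div_mod_eq)
  have "2 * (\<Sum>j<k. j) = k * (k - 1)" for k :: nat
  proof (induction k)
    case (Suc k)
    then show ?case by (cases k) simp_all
  qed simp
  from this[of a] have "(\<Sum>j<a. j) = (4 * q + 3) * (2 * q + 1)" unfolding q by simp
  then show ?thesis by simp
qed

lemma odd_card_odd_lessThan:
  assumes "(m::nat) mod 4 = 3"
  shows "odd (card {i. i < m \<and> odd i})"
proof -
  obtain q where q: "m = 4 * q + 3" using assms by (metis mult_div_mod_eq)
  have "{i. i < m \<and> odd i} = (\<lambda>k. 2 * k + 1) ` {..<2 * q + 1}"
    unfolding q by (auto elim!: oddE)
  then have "card {i. i < m \<and> odd i} = 2 * q + 1"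
    by (simp add: card_image inj_on_def)
  then show ?thesis by simp
qed

text \<open>Row \<open>i\<close> adds \<open>i\<close> times a triangular number to the weight. If
  the row with index 1 had two cells, the odd terms would be exactly those of the odd
  \<open>i < m\<close>, with \<open>m\<close> the length of the column with index 1, and
  \<open>m mod 4 = 3\<close> makes their number odd.\<close>

lemma hook_of_even_binomials:
  assumes lam: "is_partition lam n" and "rowlen lam 0 \<ge> 2" "length lam \<ge> 2"
    and row: "\<And>i k. 1 \<le> k \<Longrightarrow> k \<le> rowlen lam (Suc i) \<Longrightarrow> even ((rowlen lam i + k) choose k)"
    and column: "\<And>j k. 1 \<le> k \<Longrightarrow> k \<le> collen lam (Suc j) \<Longrightarrow> even ((collen lam j + k) choose k)"
    and weight: "even (\<Sum>(i, j)\<in>cells lam. i * j)"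
  shows "rowlen lam 1 = 1"
proof (rule ccontr)
  assume ne: "rowlen lam 1 \<noteq> 1"
  have dual: "i < collen lam j \<longleftrightarrow> j < rowlen lam i" for i j
    using mem_cells_collen[OF lam] mem_cells_rowlen by metis
  have row1: "odd (rowlen lam i)" if "1 \<le> rowlen lam (Suc i)" for i
    using row[of 1 i] that by simp
  have row2: "rowlen lam i mod 4 = 3" if "2 \<le> rowlen lam (Suc i)" for i
    using row[of 2 i] that row1[of i] even_choose_two by simp
  have "lam ! 1 \<in> set lam" using assms(3) by (intro nth_mem) simp
  then have "lam ! 1 \<noteq> 0" using lam unfolding is_partition_def by metis
  then have "rowlen lam 1 \<noteq> 0" using assms(3) by (simp add: rowlen_def)
  then have r1: "rowlen lam 1 \<ge> 2" using ne by linarith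
  \<comment> \<open>An odd length that is at least 2 is at least 3. This yields first a third row,
    then a third cell in row 1, and so a column 2 of length at least 2, which the condition with
    \<open>k = 2\<close> on column 1 requires.\<close>
  have "1 < collen lam 0" using dual[of 1 0] r1 by simp
  moreover have "1 \<le> collen lam (Suc 0)" using dual[of 0 1] assms(2) by simp
  then have "odd (collen lam 0)" using column[of 1 0] by simp
  ultimately have "2 < collen lam 0" by presburger
  then have "1 \<le> rowlen lam (Suc 1)" using dual[of 2 0] by (simp add: numeral_2_eq_2)
  then have "odd (rowlen lam 1)" by (rule row1)
  then have "2 < rowlen lam 1" using r1 by presburger
  then have c2: "2 \<le> collen lam (Suc 1)" using dual[of 1 2] by (simp add: numeral_2_eq_2)
  define m where "m = collen lam 1"
  have "odd m" using column[of 1 1] c2 by (simp add: m_def)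
  then have m: "m mod 4 = 3" using column[of 2 1] c2 even_choose_two by (simp add: m_def)
  \<comment> \<open>These rows have at most a cell in column 0, and such cells have weight
    0.\<close>
  have small: "rowlen lam i \<le> 1" if "\<not> i < m" for i
    using that dual[of i 1] by (simp add: m_def)
  have big: "rowlen lam i mod 4 = 3" if "i < m" "odd i" for i
  proof (rule row2)
    \<comment> \<open>Both \<open>i\<close> and \<open>m\<close> are odd, so row
      \<open>i + 1\<close> still reaches column 1. Rows of even index contribute even terms
      anyway.\<close>
    have "Suc i < m" using that \<open>odd m\<close> by presburger
    then show "2 \<le> rowlen lam (Suc i)" using dual[of "Suc i" 1] by (simp add: m_def)
  qed
  let ?f = "\<lambda>i. i * (\<Sum>j<rowlen lam i. j)"
  have "cells lam = (SIGMA i:{..<length lam}. {..<rowlen lam i})"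
    by (auto simp: cells_def rowlen_def)
  then have "(\<Sum>(i, j)\<in>cells lam. i * j) = (\<Sum>i<length lam. ?f i)"
    by (simp add: sum.Sigma[symmetric] sum_distrib_left)
  moreover have "{i \<in> {..<length lam}. odd (?f i)} = {i. i < m \<and> odd i}"
  proof (intro set_eqI iffI)
    fix i assume "i \<in> {i \<in> {..<length lam}. odd (?f i)}"
    then have o: "odd i" "odd (\<Sum>j<rowlen lam i. j)" by simp_all
    have "i < m"
    proof (rule ccontr)
      assume "\<not> i < m"
      then have "rowlen lam i = 0 \<or> rowlen lam i = 1" using small[of i] by linarith
      then show False using o(2) by auto
    qed
    then show "i \<in> {i. i < m \<and> odd i}" using o(1) by blast
  next
    fix i assume "i \<in> {i. i < m \<and> odd i}"
    then have i: "i < m" "odd i" by simp_all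
    have "1 < rowlen lam i" using dual[of i 1] i(1) by (simp add: m_def)
    then have "i < length lam" by (auto simp: rowlen_def split: if_splits)
    then show "i \<in> {i \<in> {..<length lam}. odd (?f i)}"
      using odd_sum_lessThan[OF big[OF i]] i(2) by simp
  qed
  ultimately have "odd (\<Sum>(i, j)\<in>cells lam. i * j)"
    using even_sum_iff[of "{..<length lam}" ?f] odd_card_odd_lessThan[OF m] by simp
  then show False using weight by blast
qed

lemma partition_hook:
  assumes lam: "is_partition lam n" and "lam \<noteq> []" "rowlen lam 1 \<le> 1"
  obtains r where "r < n" "lam = (n - r) # replicate r 1"
proof -
  obtain a xs where l: "lam = a # xs" using assms(2) by (cases lam) auto
  have "x = 1" if "x \<in> set xs" for x
  proof -
    obtain i where i: "i < length xs" "x = xs ! i" using \<open>x \<in> set xs\<close> by (auto simp: in_set_conv_nth)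
    then have "x = rowlen lam (Suc i)" by (simp add: rowlen_def l)
    then have "x \<le> 1" using rowlen_mono[OF lam, of 1 "Suc i"] assms(3) by simp
    moreover have "x \<noteq> 0" using lam \<open>x \<in> set xs\<close> unfolding is_partition_def l by (metis list.set_intros(2))
    ultimately show ?thesis by linarith
  qed
  then have xs: "xs = replicate (length xs) 1" by (intro replicate_eqI) simp_all
  have "sum_list xs = length xs" by (subst xs) (simp add: sum_list_replicate)
  then have "a + length xs = n" "a \<noteq> 0" using lam by (auto simp: is_partition_def l)
  then show thesis using that[of "length xs"] xs l by simp
qed

lemma even_binomial:
  assumes "even (a::nat)" "odd b"
  shows "even (a choose b)"
proof -
  have "0 < b" using assms(2) by (rule odd_pos)
  then have "b * (a choose b) = a * ((a - 1) choose (b - 1))" by (rule times_binomial_minus1_eq)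
  then have "even (b * (a choose b))" using assms(1) by simp
  then show ?thesis using assms(2) by simp
qed

text \<open>By Pascal's rule the two binomials differ by \<open>(n - 1) choose Suc r\<close>, which
  is even because \<open>n - 1\<close> is even and \<open>Suc r\<close> is odd. This converts the
  number of polytabloids in the witness into the condition of the theorem.\<close>

lemma odd_binomial_hook:
  assumes "odd (n::nat)" "even r"
  shows "odd (n choose Suc r) \<longleftrightarrow> odd ((n - 1) choose r)"
proof -
  obtain m where m: "n = Suc m" using assms(1) by (cases n) auto
  have "even (m choose Suc r)" using assms m by (intro even_binomial) simp_all
  then show ?thesis unfolding m by simp
qed

section \<open>Lengths, words and transversals of hooks\<close>

lemma rowlen_hook:
  "rowlen (m # replicate r 1) i = (if i = 0 then m else if i \<le> r then 1 else 0)"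
  by (auto simp: rowlen_def nth_Cons')

lemma collen_hook:
  assumes lam: "is_partition (m # replicate r 1) n" and "0 < m"
  shows "collen (m # replicate r 1) j = (if j = 0 then Suc r else if j < m then 1 else 0)"
proof -
  have "i < collen (m # replicate r 1) j \<longleftrightarrow>
      i < (if j = 0 then Suc r else if j < m then 1 else 0)" for i
    unfolding mem_cells_collen[OF lam, symmetric] mem_cells_rowlen rowlen_hook
    using assms(2) by auto
  then have "{..<collen (m # replicate r 1) j} = {..<if j = 0 then Suc r else if j < m then 1 else 0}"
    by (simp only: set_eq_iff lessThan_iff simp_thms)
  then show ?thesis by (simp only: lessThan_eq_iff)
qed

lemma hook_word_support:
  assumes lam: "is_partition lam n" and hook: "lam = (n - r) # replicate r 1" "r < n"
    and w: "w \<in> words lam"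
  shows "card {p \<in> {1..n}. 0 < w p} = r" "card {p \<in> {1..n}. w p = 0} = n - r"
    "inj_on w {p \<in> {1..n}. 0 < w p}"
proof -
  have S: "sum_list lam = n" using lam by (simp add: is_partition_def)
  have fib: "card {p \<in> {1..n}. w p = i} = (if i = 0 then n - r else if i \<le> r then 1 else 0)" for i
    using card_word_fiber[OF w, of i] unfolding S unfolding hook(1) rowlen_hook .
  show zero: "card {p \<in> {1..n}. w p = 0} = n - r" using fib[of 0] by simp
  have "{1..n} = {p \<in> {1..n}. 0 < w p} \<union> {p \<in> {1..n}. w p = 0}" by auto
  then have "card {1..n} = card ({p \<in> {1..n}. 0 < w p} \<union> {p \<in> {1..n}. w p = 0})"
    by (rule arg_cong)
  also have "\<dots> = card {p \<in> {1..n}. 0 < w p} + card {p \<in> {1..n}. w p = 0}"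
    by (rule card_Un_disjoint) auto
  finally have "card {1..n} = card {p \<in> {1..n}. 0 < w p} + card {p \<in> {1..n}. w p = 0}" .
  then show "card {p \<in> {1..n}. 0 < w p} = r" using zero hook(2) by simp
  show "inj_on w {p \<in> {1..n}. 0 < w p}"
  proof (rule inj_onI)
    fix p q assume pq: "p \<in> {p \<in> {1..n}. 0 < w p}" "q \<in> {p \<in> {1..n}. 0 < w p}" "w p = w q"
    have "card {x \<in> {1..n}. w x = w p} \<le> 1" using fib[of "w p"] pq(1) by simp
    then show "p = q" using pq by (auto simp: card_le_Suc0_iff_eq)
  qed
qed

text \<open>Outside the first column every cell lies in row 0. So the first column of
  \<open>t\<close> must contain all \<open>r\<close> entries of positive row, and having
  \<open>r + 1\<close> cells it has room for one more.\<close>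

lemma transversal_hook:
  assumes lam: "is_partition lam n" and hook: "lam = (n - r) # replicate r 1" "r < n"
    and w: "w \<in> words lam" and t: "t \<in> tableaux lam"
  shows "transversal lam w t \<longleftrightarrow>
    (\<exists>z\<in>{p \<in> {1..n}. w p = 0}. col_set lam t 0 = insert z {p \<in> {1..n}. 0 < w p})"
proof -
  let ?P = "{p \<in> {1..n}. 0 < w p}" and ?A = "col_set lam t 0"
  have S: "sum_list lam = n" using lam by (simp add: is_partition_def)
  have cl: "collen lam j = (if j = 0 then Suc r else if j < n - r then 1 else 0)" for j
    using collen_hook[of "n - r" r n j] lam hook by simp
  note supp = hook_word_support[OF lam hook w]
  have A: "?A \<subseteq> {1..n}" using col_set_subset[OF t] S by simp
  show ?thesis
  proof
    assume tr: "transversal lam w t"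
    obtain z where z: "z \<in> ?A" "w z = 0" using transversal_obtain[OF tr, of 0 0] by (auto simp: cl)
    have "?A - {z} \<subseteq> ?P"
    proof
      fix x assume x: "x \<in> ?A - {z}"
      then have "w x \<noteq> w z" using transversal_equal_entries[OF tr _ z(1)] by blast
      then show "x \<in> ?P" using x A z(2) by auto
    qed
    moreover have "card (?A - {z}) = card ?P"
      using card_col_set[OF lam t, of 0] z(1) supp(1) by (simp add: cl)
    ultimately have "?A - {z} = ?P" by (intro card_subset_eq) simp_all
    then have "?A = insert z ?P" using z(1) by blast
    then show "\<exists>z\<in>{p \<in> {1..n}. w p = 0}. ?A = insert z ?P" using z A by blast
  next
    assume "\<exists>z\<in>{p \<in> {1..n}. w p = 0}. ?A = insert z ?P"
    then obtain z where z: "z \<in> {1..n}" "w z = 0" "?A = insert z ?P" by blast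
    have "bij_betw w (col_set lam t j) {..<collen lam j}" for j
    proof (cases "j = 0")
      case True
      have inj: "inj_on w ?A" unfolding z(3) using supp(3) z(2) by (auto simp: inj_on_insert)
      have "w ` ?A \<subseteq> {..<Suc r}"
      proof
        fix y assume "y \<in> w ` ?A"
        then obtain p where p: "p \<in> ?A" "y = w p" by blast
        have "p \<in> {x \<in> {1..n}. w x = y}" using p A by blast
        moreover have "finite {x \<in> {1..n}. w x = y}" by simp
        ultimately have "rowlen lam y \<noteq> 0"
          using card_word_fiber[OF w, of y] S by (metis card_0_eq empty_iff)
        then show "y \<in> {..<Suc r}" unfolding hook(1) rowlen_hook by (auto split: if_splits)
      qed
      moreover have "card (w ` ?A) = card {..<Suc r}"
        using card_image[OF inj] card_col_set[OF lam t, of 0] by (simp add: cl)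
      ultimately have "w ` ?A = {..<Suc r}" by (intro card_subset_eq) simp_all
      then show ?thesis using inj True by (simp add: bij_betw_def cl)
    next
      case False
      \<comment> \<open>The remaining columns have at most one cell each, where \<open>w\<close>
        vanishes because the first column already holds the whole support.\<close>
      have "w p = 0" if "p \<in> col_set lam t j" for p
      proof -
        have "p \<in> {1..n}" using \<open>p \<in> col_set lam t j\<close> col_set_subset[OF t] S by blast
        moreover have "p \<notin> ?A" using \<open>p \<in> col_set lam t j\<close> False col_set_disjoint[OF t] by blast
        ultimately show ?thesis unfolding z(3) by simp
      qed
      moreover have "card (col_set lam t j) = (if j < n - r then 1 else 0)"
        using card_col_set[OF lam t, of j] False by (simp add: cl)
      ultimately show ?thesis
        using False by (cases "j < n - r") (auto simp: cl card_1_singleton_iff bij_betw_def lessThan_Suc)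
    qed
    then show "transversal lam w t" by (simp add: transversal_def)
  qed
qed

text \<open>
  The witness is the sum of one polytabloid for each possible first column \<open>A\<close>.
\<close>

lemma hook_constant_vector:
  assumes ch: "CHAR('f::field) = 2" and lam: "is_partition lam n"
    and hook: "lam = (n - r) # replicate r 1" "r < n" and "odd (n - r)"
  shows "\<exists>v :: tabloid \<Rightarrow> 'f. v \<in> specht lam \<and> (\<forall>w\<in>words lam. coef lam v w = 1) \<and>
    (\<forall>\<phi> t. invariant_functional lam \<phi> \<longrightarrow> t \<in> tableaux lam \<longrightarrow>
      \<phi> v = of_nat (n choose Suc r) * \<phi> (polytabloid lam t))"
proof -
  have S: "sum_list lam = n" using lam by (simp add: is_partition_def)
  have cl: "collen lam 0 = Suc r"
    using collen_hook[of "n - r" r n 0] lam hook by simp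
  obtain t0 where t0: "t0 \<in> tableaux lam" using tableaux_nonempty by blast
  define Sub where "Sub = {A. A \<subseteq> {1..n} \<and> card A = Suc r}"
  have finSub: "finite Sub" by (simp add: Sub_def)
  have cardSub: "card Sub = n choose Suc r"
    using n_subsets[of "{1..n}" "Suc r"] by (simp add: Sub_def)
  have "\<exists>t\<in>tableaux lam. col_set lam t 0 = A" if A: "A \<in> Sub" for A
  proof -
    have 1: "col_set lam t0 0 \<subseteq> {1..n}" using col_set_subset[OF t0] S by blast
    have 2: "card (col_set lam t0 0) = card A"
      using card_col_set[OF lam t0, of 0] A cl by (simp add: Sub_def)
    obtain p where p: "p permutes {1..n}" "p ` col_set lam t0 0 = A"
      using obtain_permutes_image[OF _ 1 _ 2] A by (auto simp: Sub_def)
    have "p \<circ> t0 \<in> tableaux lam" by (rule comp_in_tableaux[OF t0]) (simp only: S p(1))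
    then show ?thesis using p(2) col_set_comp[of lam p t0 0] by blast
  qed
  then obtain T where T: "\<And>A. A \<in> Sub \<Longrightarrow> T A \<in> tableaux lam"
    "\<And>A. A \<in> Sub \<Longrightarrow> col_set lam (T A) 0 = A" by metis
  let ?v = "\<Sum>A\<in>Sub. polytabloid lam (T A) :: tabloid \<Rightarrow> 'f"
  have "?v \<in> specht lam" by (intro specht_sum polytabloid_in_specht T)
  moreover have "coef lam ?v w = 1" if w: "w \<in> words lam" for w
  proof -
    let ?Z = "{p \<in> {1..n}. w p = 0}" and ?P = "{p \<in> {1..n}. 0 < w p}"
    have "coef lam ?v w = (\<Sum>A\<in>Sub. of_bool (\<exists>z\<in>?Z. A = insert z ?P))"
      unfolding coef_sum
    proof (rule sum.cong)
      fix A assume A: "A \<in> Sub"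
      show "coef lam (polytabloid lam (T A)) w = (of_bool (\<exists>z\<in>?Z. A = insert z ?P) :: 'f)"
        by (simp only: coef_polytabloid[OF ch lam T(1)[OF A] w]
            transversal_hook[OF lam hook w T(1)[OF A]] T(2)[OF A])
    qed simp
    also have "\<dots> = of_nat (card {A \<in> Sub. \<exists>z\<in>?Z. A = insert z ?P})"
      using finSub by (simp add: of_bool_def sum.If_cases Int_def)
    \<comment> \<open>The first columns that fit \<open>w\<close> add to its support one of the
      \<open>n - r\<close> entries of row 0, an odd number of choices.\<close>
    also have "{A \<in> Sub. \<exists>z\<in>?Z. A = insert z ?P} = (\<lambda>z. insert z ?P) ` ?Z"
    proof -
      have "insert z ?P \<in> Sub" if "z \<in> ?Z" for z
      proof -
        have "card (insert z ?P) = Suc (card ?P)" using that by (intro card_insert_disjoint) simp_all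
        then show ?thesis using that hook_word_support(1)[OF lam hook w] by (auto simp: Sub_def)
      qed
      then show ?thesis by blast
    qed
    also have "card \<dots> = card ?Z"
      by (rule card_image) (auto simp: inj_on_def)
    also have "\<dots> = n - r" by (rule hook_word_support(2)[OF lam hook w])
    finally show ?thesis using char_2_of_nat[OF ch, of "n - r"] assms(5) by simp
  qed
  moreover have "\<phi> ?v = of_nat (n choose Suc r) * \<phi> (polytabloid lam t)"
    if inv: "invariant_functional lam \<phi>" and t: "t \<in> tableaux lam"
    for \<phi> :: "(tabloid \<Rightarrow> 'f) \<Rightarrow> 'f" and t
  proof -
    have "\<phi> ?v = (\<Sum>A\<in>Sub. \<phi> (polytabloid lam (T A)))"
      by (intro invariant_functional_sum[OF inv] polytabloid_in_specht T)
    also have "\<dots> = (\<Sum>A\<in>Sub. \<phi> (polytabloid lam t))"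
      by (intro sum.cong refl invariant_functional_polytabloid[OF inv t] T)
    finally show ?thesis using cardSub by simp
  qed
  ultimately show ?thesis by blast
qed

text \<open>
  The functional sums the coefficients at one word for each possible support \<open>P\<close>; on a polytabloid
  it counts the \<open>r + 1\<close> ways to delete one entry from the first column.
\<close>

lemma hook_invariant_functional:
  assumes ch: "CHAR('f::field) = 2" and lam: "is_partition lam n"
    and hook: "lam = (n - r) # replicate r 1" "r < n" and "even r"
  shows "\<exists>\<phi> :: (tabloid \<Rightarrow> 'f) \<Rightarrow> 'f. invariant_functional lam \<phi> \<and>
    (\<forall>t\<in>tableaux lam. \<phi> (polytabloid lam t) = 1)"
proof -
  have S: "sum_list lam = n" using lam by (simp add: is_partition_def)
  have cl: "collen lam 0 = Suc r"
    using collen_hook[of "n - r" r n 0] lam hook by simp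
  define Sub where "Sub = {P. P \<subseteq> {1..n} \<and> card P = r}"
  have finSub: "finite Sub" by (simp add: Sub_def)
  obtain w0 where w0: "w0 \<in> words lam"
    using tableaux_nonempty[of lam] by (auto simp: words_def)
  \<comment> \<open>For a hook the coefficient of a polytabloid at a word depends only on the
    support of the word, so any word with support \<open>P\<close> may represent it.\<close>
  have "\<exists>w\<in>words lam. {p \<in> {1..n}. 0 < w p} = P" if P: "P \<in> Sub" for P
  proof -
    let ?P0 = "{p \<in> {1..n}. 0 < w0 p}"
    have 1: "P \<subseteq> {1..n}" "?P0 \<subseteq> {1..n}" using P by (auto simp: Sub_def)
    have 2: "card P = card ?P0" using P hook_word_support(1)[OF lam hook w0] by (simp add: Sub_def)
    obtain p where p: "p permutes {1..n}" "p ` P = ?P0"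
      using obtain_permutes_image[OF finite_atLeastAtMost 1 2] .
    have "w0 \<circ> p \<in> words lam" by (rule words_comp[OF w0]) (simp only: S p(1))
    moreover have "{q \<in> {1..n}. 0 < (w0 \<circ> p) q} = P"
    proof (intro set_eqI iffI)
      fix q assume "q \<in> {q \<in> {1..n}. 0 < (w0 \<circ> p) q}"
      then have "p q \<in> ?P0" using permutes_in_image[OF p(1)] by simp
      then show "q \<in> P" unfolding p(2)[symmetric] using permutes_inj[OF p(1)] by (simp add: inj_image_mem_iff)
    next
      fix q assume q: "q \<in> P"
      then have "p q \<in> ?P0" unfolding p(2)[symmetric] by (rule imageI)
      then show "q \<in> {q \<in> {1..n}. 0 < (w0 \<circ> p) q}" using q 1(1) by auto
    qed
    ultimately show ?thesis by blast
  qed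
  then obtain W where W: "\<And>P. P \<in> Sub \<Longrightarrow> W P \<in> words lam"
    "\<And>P. P \<in> Sub \<Longrightarrow> {p \<in> {1..n}. 0 < W P p} = P" by metis
  define \<phi> :: "(tabloid \<Rightarrow> 'f) \<Rightarrow> 'f" where "\<phi> = (\<lambda>x. \<Sum>P\<in>Sub. coef lam x (W P))"
  have one: "\<phi> (polytabloid lam t) = 1" if t: "t \<in> tableaux lam" for t
  proof -
    let ?A = "col_set lam t 0"
    have A: "?A \<subseteq> {1..n}" "card ?A = Suc r" "finite ?A"
      using col_set_subset[OF t] S card_col_set[OF lam t, of 0] cl by simp_all
    have "\<phi> (polytabloid lam t) = (\<Sum>P\<in>Sub. of_bool (\<exists>z\<in>{1..n} - P. ?A = insert z P))"
      unfolding \<phi>_def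
    proof (rule sum.cong)
      fix P assume P: "P \<in> Sub"
      have "{p \<in> {1..n}. W P p = 0} = {1..n} - {p \<in> {1..n}. 0 < W P p}" by auto
      then have "{p \<in> {1..n}. W P p = 0} = {1..n} - P" by (simp only: W(2)[OF P])
      then show "coef lam (polytabloid lam t) (W P) =
          (of_bool (\<exists>z\<in>{1..n} - P. ?A = insert z P) :: 'f)"
        by (simp only: coef_polytabloid[OF ch lam t W(1)[OF P]]
            transversal_hook[OF lam hook W(1)[OF P] t] W(2)[OF P])
    qed simp
    also have "\<dots> = of_nat (card {P \<in> Sub. \<exists>z\<in>{1..n} - P. ?A = insert z P})"
      using finSub by (simp add: of_bool_def sum.If_cases Int_def)
    also have "{P \<in> Sub. \<exists>z\<in>{1..n} - P. ?A = insert z P} = (\<lambda>z. ?A - {z}) ` ?A"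
    proof (intro set_eqI iffI)
      fix P assume "P \<in> {P \<in> Sub. \<exists>z\<in>{1..n} - P. ?A = insert z P}"
      then show "P \<in> (\<lambda>z. ?A - {z}) ` ?A" by auto
    next
      fix P assume "P \<in> (\<lambda>z. ?A - {z}) ` ?A"
      then obtain z where z: "z \<in> ?A" "P = ?A - {z}" by blast
      have "P \<in> Sub" using z A by (auto simp: Sub_def)
      moreover have "z \<in> {1..n} - P" "?A = insert z P" using z A(1) by auto
      ultimately show "P \<in> {P \<in> Sub. \<exists>z\<in>{1..n} - P. ?A = insert z P}" by blast
    qed
    also have "card \<dots> = card ?A" by (rule card_image) (auto simp: inj_on_def)
    finally show ?thesis using A(2) char_2_of_nat[OF ch, of "Suc r"] \<open>even r\<close> by simp
  qed
  have add: "\<phi> (x + y) = \<phi> x + \<phi> y" for x y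
    by (simp only: \<phi>_def coef_add sum.distrib)
  have scale: "\<phi> (fscale c x) = c * \<phi> x" for c x
    by (simp only: \<phi>_def coef_fscale sum_distrib_left)
  \<comment> \<open>Invariance is not visible from the choice of the words \<open>W P\<close>. It
    follows since the group permutes the polytabloids, all of which have value 1.\<close>
  have "\<phi> (act p x) = \<phi> x" if p: "p permutes {1..sum_list lam}" and "x \<in> specht lam" for p x
    using that(2)
  proof (induction rule: specht_induct)
    case zero
    show ?case by (simp only: act_zero)
  next
    case (add x y c)
    then show ?case by (simp only: act_add act_fscale \<open>\<And>x y. \<phi> (x + y) = \<phi> x + \<phi> y\<close> scale)
  next
    case (polytabloid t)
    show ?case
      unfolding act_polytabloid[OF p]
      by (simp only: one[OF polytabloid] one[OF comp_in_tableaux[OF polytabloid p]])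
  qed
  then have "invariant_functional lam \<phi>"
    unfolding invariant_functional_def using add scale by blast
  then show ?thesis using one by blast
qed

theorem corollary4p2:
  fixes lam :: "nat list" and n :: nat
  assumes "CHAR('f::field) = 2"
    and "is_partition lam n"
    and "fvs.dim (specht lam :: (tabloid \<Rightarrow> 'f) set) > 1"
  shows "has_one_dim_summand lam (specht lam :: (tabloid \<Rightarrow> 'f) set) \<longleftrightarrow>
    (\<exists>r. r < n \<and> lam = (n - r) # replicate r 1 \<and> odd n \<and> even r \<and> odd ((n - 1) choose r))"
proof
  note ch = assms(1) and lam = assms(2)
  assume "has_one_dim_summand lam (specht lam :: (tabloid \<Rightarrow> 'f) set)"
  then obtain \<phi> and v :: "tabloid \<Rightarrow> 'f" where inv: "invariant_functional lam \<phi>"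
    and v: "v \<in> specht lam" "\<And>w. w \<in> words lam \<Longrightarrow> coef lam v w = 1" "\<phi> v = 1"
    using one_dim_summand_imp_functional[OF ch] by metis
  have len: "length lam \<ge> 2"
    using dim_specht_single_row[of lam, where 'f = 'f] assms(3) by linarith
  have r0: "rowlen lam 0 \<ge> 2"
    using dim_specht_single_column[OF ch lam] assms(3) by linarith
  obtain t where t: "t \<in> tableaux lam" using tableaux_nonempty by blast
  \<comment> \<open>A zero value on one polytabloid would spread to all of them, hence to
    \<open>v\<close>.\<close>
  have nz: "\<phi> (polytabloid lam t) \<noteq> 0"
  proof
    assume z: "\<phi> (polytabloid lam t) = 0"
    have "\<phi> v = 0"
      using v(1)
    proof (induction rule: specht_induct)
      case zero
      show ?case by (rule invariant_functional_zero[OF inv])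
    next
      case (add x y c)
      have "\<phi> (fscale c x + y) = c * \<phi> x + \<phi> y"
        by (simp only: invariant_functional_add[OF inv specht_fscale[OF add.hyps(1)] add.hyps(2)]
            invariant_functional_fscale[OF inv add.hyps(1)])
      then show ?case unfolding add.IH by (simp only: mult_zero_right add_0_left)
    next
      case (polytabloid s)
      then show ?case using invariant_functional_polytabloid[OF inv t] z by simp
    qed
    then show False using v(3) by simp
  qed
  have row: "even ((rowlen lam i + k) choose k)" if "1 \<le> k" "k \<le> rowlen lam (Suc i)" for i k
    by (rule row_condition[OF ch lam v(1,2) that])
  have column: "even ((collen lam j + k) choose k)" if "1 \<le> k" "k \<le> collen lam (Suc j)" for j k
    by (rule column_condition[OF ch lam inv t nz that])
  have weight: "even (\<Sum>(i, j)\<in>cells lam. i * j)" by (rule even_cell_weight[OF ch lam inv v])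
  have r1: "rowlen lam 1 = 1" by (rule hook_of_even_binomials[OF lam r0 len row column weight])
  have "lam \<noteq> []" using len by auto
  then obtain r where r: "r < n" "lam = (n - r) # replicate r 1"
    using partition_hook[OF lam] r1 by auto
  \<comment> \<open>This makes column 1 nonempty, so that the condition for \<open>k = 1\<close>
    applies to column 0.\<close>
  have "n - r \<ge> 2" using r0 unfolding r(2) rowlen_hook by simp
  have "odd (rowlen lam 0)" using row[of 1 0] r1 by simp
  then have oddnr: "odd (n - r)" unfolding r(2) rowlen_hook by simp
  have cl: "collen lam j = (if j = 0 then Suc r else if j < n - r then 1 else 0)" for j
    using collen_hook[of "n - r" r n j] lam r by simp
  have "odd (collen lam 0)" using column[of 1 0] cl[of 1] \<open>n - r \<ge> 2\<close> by simp
  then have er: "even r" using cl[of 0] by simp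
  have on: "odd n" using oddnr er r(1) by simp
  obtain v' :: "tabloid \<Rightarrow> 'f" where v': "v' \<in> specht lam"
    "\<And>w. w \<in> words lam \<Longrightarrow> coef lam v' w = 1"
    "\<phi> v' = of_nat (n choose Suc r) * \<phi> (polytabloid lam t)"
    using hook_constant_vector[OF ch lam r(2,1) oddnr] inv t by metis
  \<comment> \<open>Both vectors have all coefficients 1, so the number of polytabloids in
    \<open>v'\<close> computes \<open>\<phi> v = 1\<close>.\<close>
  have "v' = v"
    by (rule specht_eqI[OF v'(1) v(1)]) (simp only: v(2) v'(2))
  then have "of_nat (n choose Suc r) * \<phi> (polytabloid lam t) = 1" using v'(3) v(3) by metis
  then have "odd (n choose Suc r)" unfolding char_2_of_nat[OF ch] by (cases "odd (n choose Suc r)") simp_all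
  then have "odd ((n - 1) choose r)" using odd_binomial_hook[OF on er] by blast
  then show "\<exists>r. r < n \<and> lam = (n - r) # replicate r 1 \<and> odd n \<and> even r \<and> odd ((n - 1) choose r)"
    using r on er by blast
next
  note ch = assms(1) and lam = assms(2)
  assume "\<exists>r. r < n \<and> lam = (n - r) # replicate r 1 \<and> odd n \<and> even r \<and> odd ((n - 1) choose r)"
  then obtain r where r: "r < n" "lam = (n - r) # replicate r 1" "odd n" "even r"
    "odd ((n - 1) choose r)" by blast
  have "odd (n - r)" using r by simp
  obtain \<phi> :: "(tabloid \<Rightarrow> 'f) \<Rightarrow> 'f" where \<phi>: "invariant_functional lam \<phi>"
    "\<And>t. t \<in> tableaux lam \<Longrightarrow> \<phi> (polytabloid lam t) = 1"
    using hook_invariant_functional[OF ch lam r(2,1,4)] by metis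
  obtain t where t: "t \<in> tableaux lam" using tableaux_nonempty by blast
  obtain v :: "tabloid \<Rightarrow> 'f" where v: "v \<in> specht lam"
    "\<And>w. w \<in> words lam \<Longrightarrow> coef lam v w = 1"
    "\<phi> v = of_nat (n choose Suc r) * \<phi> (polytabloid lam t)"
    using hook_constant_vector[OF ch lam r(2,1) \<open>odd (n - r)\<close>] \<phi>(1) t by metis
  have "\<phi> v = 1"
    using v(3) \<phi>(2)[OF t] odd_binomial_hook[OF r(3,4)] r(5) char_2_of_nat[OF ch, of "n choose Suc r"]
    by simp
  then show "has_one_dim_summand lam (specht lam :: (tabloid \<Rightarrow> 'f) set)"
    using functional_imp_one_dim_summand[OF \<phi>(1) v(1,2)] by blast
qed

end
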